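(* Let $Q$ be a quasigroup, let $H=\{H_p\}_{p\in Q}$ be a $Q$-graded Hopf quasigroup, and let $M=\{M_q\}_{q\in Q}$ be a $Q$-graded $H$-Hopf quasimodule. Then there is an isomorphism of $Q$-graded $H$-Hopf quasimodules $$H\otimes M^{coH}\cong M,$$ where $H\otimes M^{coH}=\{H_q\otimes M^{coH}\}_{q\in Q}$ has action $h\cdot(g\otimes m)=hg\otimes m$ ($h\in H_p$, $g\in H_q$, $m\in M^{coH}$) and coactions $\rho_q(g\otimes m)=g_{(1)}\otimes (g_{(2)}\otimes m)$.
   Context: Fix a field $k$; all vector spaces, linear maps and tensor products are over $k$. A quasigroup is a set $Q$ with a (not necessarily associative) product and a two-sided identity $e$ such that for each $p\in Q$ there is $p^{-1}\in Q$ with $p^{-1}(pq)=q$ and $(qp)p^{-1}=q$ for all $q\in Q$ (then inverses are unique, $(p^{-1})^{-1}=p$ and $(pq)^{-1}=q^{-1}p^{-1}$). Graded components whose indices are equal in $Q$ are the same space. A $Q$-graded Hopf quasigroup $H$ consists of: a family $\{H_p\}_{p\in Q}$ of vector spaces with linear maps $m_{p,q}:H_p\otimes H_q\to H_{pq}$, written $hg=m_{p,q}(h\otimes g)$ (not assumed associative), and a linear map $\mu:k\to H_e$ with $1=\mu(1_k)$ satisfying $h1=h=1h$; on each $H_p$ a coassociative counital coalgebra structure $(\Delta_p,\epsilon_p)$, written $\Delta_p(h)=h_{(1)}\otimes h_{(2)}$ (summation omitted), such that all $m_{p,q}$ and $\mu$ are coalgebra maps; and linear maps $S_p:H_p\to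 H_{p^{-1}}$ (antipode) such that for all $p,q\in Q$, $h\in H_p$, $g\in H_q$: $S_p(h_{(1)})(h_{(2)}g)=\epsilon_p(h)g=h_{(1)}(S_p(h_{(2)})g)$ and $(gS_p(h_{(1)}))h_{(2)}=g\epsilon_p(h)=(gh_{(1)})S_p(h_{(2)})$. A $Q$-graded $H$-quasimodule is a family $M=\{M_q\}_{q\in Q}$ of vector spaces with linear maps $\varphi_{p,q}:H_p\otimes M_q\to M_{pq}$, written $h\cdot m$, such that $1\cdot m=m$ and $h_{(1)}\cdot(S_p(h_{(2)})\cdot m)=S_p(h_{(1)})\cdot(h_{(2)}\cdot m)=\epsilon_p(h)m$ for all $p,q\in Q$, $h\in H_p$, $m\in M_q$. A map of $Q$-graded $H$-quasimodules $M\to N$ is a family of linear maps $f_q:M_q\to N_q$ with $f_q(h_{(1)}\cdot(S_p(h_{(2)})\cdot m))=h_{(1)}\cdot(S_p(h_{(2)})\cdot f_q(m))$ for all $p,q\in Q$, $h\in H_p$, $m\in M_q$. A $Q$-graded $H$-Hopf quasimodule is a $Q$-graded $H$-quasimodule $M$ such that each $M_q$ is a coassociative counital left $H_q$-comodule via $\rho_q:M_q\to H_q\otimes M_q$, $\rho_q(m)=m_{(-1)}\otimes m_{(0)}$, and $\rho_{pq}(h\cdot m)=h_{(1)}m_{(-1)}\otimes h_{(2)}\cdot m_{(0)}$ for all $p,q\in Q$, $h\in H_p$, $m\in M_q$. A map of $Q$-graded $H$-Hopf quasimodules is a map $f=\{f_q\}$ of $Q$-graded $H$-quasimodules with $m_{(-1)}\otimes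 f_q(m_{(0)})=f_q(m)_{(-1)}\otimes f_q(m)_{(0)}$ for all $q\in Q$, $m\in M_q$; it is an isomorphism if every $f_q$ is bijective. The coinvariants of $M$ are $M^{coH}=\{m\in M_e : \rho_e(m)=1\otimes m\}$. *)

theory Defs
  imports "HOL-Algebra.Module" "HOL-Algebra.AbelCoset"
begin

section \<open>Linear maps and tensor products\<close>

text \<open>
  Vector spaces over a field \<open>K\<close> are HOL-Algebra modules over \<open>K\<close>. Only the carrier, addition,
  zero and scalar multiplication of the record matter; the inherited fields \<open>mult\<close> and \<open>one\<close> are
  ignored.
\<close>

definition linear_map ::
    "'k ring \<Rightarrow> ('k, 'a) module \<Rightarrow> ('k, 'b) module \<Rightarrow> ('a \<Rightarrow> 'b) \<Rightarrow> bool" where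
  "linear_map K V W f \<longleftrightarrow>
     f \<in> carrier V \<rightarrow> carrier W \<and>
     (\<forall>x\<in>carrier V. \<forall>y\<in>carrier V. f (x \<oplus>\<^bsub>V\<^esub> y) = f x \<oplus>\<^bsub>W\<^esub> f y) \<and>
     (\<forall>a\<in>carrier K. \<forall>x\<in>carrier V. f (a \<odot>\<^bsub>V\<^esub> x) = a \<odot>\<^bsub>W\<^esub> f x)"

definition scalars :: "'k ring \<Rightarrow> ('k, 'k) module" where
  "scalars K = \<lparr>carrier = carrier K, mult = mult K, one = one K, zero = zero K, add = add K,
                smult = mult K\<rparr>"

definition free_module :: "'k ring \<Rightarrow> 'x set \<Rightarrow> ('k, 'x \<Rightarrow> 'k) module" where
  "free_module K X =
     \<lparr>carrier = {c. range c \<subseteq> carrier K \<and> finite {x. c x \<noteq> \<zero>\<^bsub>K\<^esub>} \<and> {x. c x \<noteq> \<zero>\<^bsub>K\<^esub>} \<subseteq> X},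
      mult = (\<lambda>_ _. undefined), one = undefined,
      zero = (\<lambda>_. \<zero>\<^bsub>K\<^esub>), add = (\<lambda>c d x. c x \<oplus>\<^bsub>K\<^esub> d x),
      smult = (\<lambda>a c x. a \<otimes>\<^bsub>K\<^esub> c x)\<rparr>"

definition free_basis :: "'k ring \<Rightarrow> 'x \<Rightarrow> 'x \<Rightarrow> 'k" where
  "free_basis K x = (\<lambda>y. if y = x then \<one>\<^bsub>K\<^esub> else \<zero>\<^bsub>K\<^esub>)"

definition quotient_module :: "('k, 'a) module \<Rightarrow> 'a set \<Rightarrow> ('k, 'a set) module" where
  "quotient_module F N =
     \<lparr>carrier = a_rcosets\<^bsub>F\<^esub> N,
      mult = (\<lambda>_ _. undefined), one = undefined,
      zero = N, add = set_add F,
      smult = (\<lambda>a C. ((\<lambda>x. a \<odot>\<^bsub>F\<^esub> x) ` C) <+>\<^bsub>F\<^esub> N)\<rparr>"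

definition submodule_span :: "'k ring \<Rightarrow> ('k, 'a) module \<Rightarrow> 'a set \<Rightarrow> 'a set" where
  "submodule_span K F R = \<Inter>{N. submodule N K F \<and> R \<subseteq> N}"

text \<open>
  The tensor product is the free module on pairs modulo bilinearity, so its elements are sets of
  formal linear combinations of pairs.
\<close>

type_synonym ('k, 'a, 'b) tens = "('a \<times> 'b \<Rightarrow> 'k) set"

definition bilinearity_relators ::
    "'k ring \<Rightarrow> ('k, 'a) module \<Rightarrow> ('k, 'b) module \<Rightarrow> ('a \<times> 'b \<Rightarrow> 'k) set" where
  "bilinearity_relators K V W =
     (let F = free_module K (carrier V \<times> carrier W); d = (\<lambda>v w. free_basis K (v, w)) in
       {d (v \<oplus>\<^bsub>V\<^esub> v') w \<ominus>\<^bsub>F\<^esub> (d v w \<oplus>\<^bsub>F\<^esub> d v' w) | v v' w.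
          v \<in> carrier V \<and> v' \<in> carrier V \<and> w \<in> carrier W} \<union>
       {d v (w \<oplus>\<^bsub>W\<^esub> w') \<ominus>\<^bsub>F\<^esub> (d v w \<oplus>\<^bsub>F\<^esub> d v w') | v w w'.
          v \<in> carrier V \<and> w \<in> carrier W \<and> w' \<in> carrier W} \<union>
       {d (a \<odot>\<^bsub>V\<^esub> v) w \<ominus>\<^bsub>F\<^esub> (a \<odot>\<^bsub>F\<^esub> d v w) | a v w.
          a \<in> carrier K \<and> v \<in> carrier V \<and> w \<in> carrier W} \<union>
       {d v (a \<odot>\<^bsub>W\<^esub> w) \<ominus>\<^bsub>F\<^esub> (a \<odot>\<^bsub>F\<^esub> d v w) | a v w.
          a \<in> carrier K \<and> v \<in> carrier V \<and> w \<in> carrier W})"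

definition tensor_rel ::
    "'k ring \<Rightarrow> ('k, 'a) module \<Rightarrow> ('k, 'b) module \<Rightarrow> ('a \<times> 'b \<Rightarrow> 'k) set" where
  "tensor_rel K V W =
     submodule_span K (free_module K (carrier V \<times> carrier W)) (bilinearity_relators K V W)"

definition tensor ::
    "'k ring \<Rightarrow> ('k, 'a) module \<Rightarrow> ('k, 'b) module \<Rightarrow> ('k, ('k, 'a, 'b) tens) module" where
  "tensor K V W = quotient_module (free_module K (carrier V \<times> carrier W)) (tensor_rel K V W)"

definition pure ::
    "'k ring \<Rightarrow> ('k, 'a) module \<Rightarrow> ('k, 'b) module \<Rightarrow> 'a \<Rightarrow> 'b \<Rightarrow> ('k, 'a, 'b) tens" where
  "pure K V W v w =
     tensor_rel K V W +>\<^bsub>free_module K (carrier V \<times> carrier W)\<^esub> free_basis K (v, w)"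

text \<open>
  \<open>lift K Z t B\<close> is the image of the tensor \<open>t\<close> under the linear map induced by a bilinear map \<open>B\<close>
  with values in \<open>Z\<close>: if \<open>t\<close> is the sum of the \<open>v\<^sub>i \<otimes> w\<^sub>i\<close>, it is the sum of the \<open>B v\<^sub>i w\<^sub>i\<close>. It is
  evaluated on a chosen representative of \<open>t\<close>; for bilinear \<open>B\<close> the choice is immaterial.
  Thus Sweedler expressions such as \<open>B h\<^sub>(\<^sub>1\<^sub>) h\<^sub>(\<^sub>2\<^sub>)\<close> become \<open>lift K Z (\<Delta> h) B\<close>.
\<close>

definition lift ::
    "'k ring \<Rightarrow> ('k, 'z) module \<Rightarrow> ('k, 'a, 'b) tens \<Rightarrow> ('a \<Rightarrow> 'b \<Rightarrow> 'z) \<Rightarrow> 'z" where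
  "lift K Z t B =
     (let c = (SOME c. c \<in> t) in
       \<Oplus>\<^bsub>Z\<^esub> x \<in> {x. c x \<noteq> \<zero>\<^bsub>K\<^esub>}. c x \<odot>\<^bsub>Z\<^esub> B (fst x) (snd x))"

definition tensor_map ::
    "'k ring \<Rightarrow> ('k, 'c) module \<Rightarrow> ('k, 'd) module \<Rightarrow> ('a \<Rightarrow> 'c) \<Rightarrow> ('b \<Rightarrow> 'd)
      \<Rightarrow> ('k, 'a, 'b) tens \<Rightarrow> ('k, 'c, 'd) tens" where
  "tensor_map K V' W' f g t = lift K (tensor K V' W') t (\<lambda>v w. pure K V' W' (f v) (g w))"

text \<open>The canonical map from \<open>(U \<otimes> V) \<otimes> W\<close> to \<open>U \<otimes> (V \<otimes> W)\<close>.\<close>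

definition tensor_assoc ::
    "'k ring \<Rightarrow> ('k, 'a) module \<Rightarrow> ('k, 'b) module \<Rightarrow> ('k, 'c) module
      \<Rightarrow> ('k, ('k, 'a, 'b) tens, 'c) tens \<Rightarrow> ('k, 'a, ('k, 'b, 'c) tens) tens" where
  "tensor_assoc K U V W t =
     lift K (tensor K U (tensor K V W)) t (\<lambda>s w.
       lift K (tensor K U (tensor K V W)) s (\<lambda>u v.
         pure K U (tensor K V W) u (pure K V W v w)))"


section \<open>Coalgebras and comodules\<close>

definition coalgebra ::
    "'k ring \<Rightarrow> ('k, 'c) module \<Rightarrow> ('c \<Rightarrow> ('k, 'c, 'c) tens) \<Rightarrow> ('c \<Rightarrow> 'k) \<Rightarrow> bool" where
  "coalgebra K C \<Delta> \<epsilon> \<longleftrightarrow>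
     linear_map K C (tensor K C C) \<Delta> \<and> linear_map K C (scalars K) \<epsilon> \<and>
     (\<forall>c\<in>carrier C.
        tensor_assoc K C C C (tensor_map K (tensor K C C) C \<Delta> (\<lambda>x. x) (\<Delta> c))
          = tensor_map K C (tensor K C C) (\<lambda>x. x) \<Delta> (\<Delta> c) \<and>
        lift K C (\<Delta> c) (\<lambda>x y. \<epsilon> x \<odot>\<^bsub>C\<^esub> y) = c \<and>
        lift K C (\<Delta> c) (\<lambda>x y. \<epsilon> y \<odot>\<^bsub>C\<^esub> x) = c)"

definition coalgebra_map ::
    "'k ring \<Rightarrow> ('k, 'c) module \<Rightarrow> ('c \<Rightarrow> ('k, 'c, 'c) tens) \<Rightarrow> ('c \<Rightarrow> 'k)
      \<Rightarrow> ('k, 'd) module \<Rightarrow> ('d \<Rightarrow> ('k, 'd, 'd) tens) \<Rightarrow> ('d \<Rightarrow> 'k) \<Rightarrow> ('c \<Rightarrow> 'd) \<Rightarrow> bool" where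
  "coalgebra_map K C \<Delta> \<epsilon> D \<Delta>' \<epsilon>' f \<longleftrightarrow>
     linear_map K C D f \<and>
     (\<forall>c\<in>carrier C. \<Delta>' (f c) = tensor_map K D D f f (\<Delta> c) \<and> \<epsilon>' (f c) = \<epsilon> c)"

text \<open>The coalgebra structures on the ground field and on the tensor product of two coalgebras.\<close>

definition scalars_comult :: "'k ring \<Rightarrow> 'k \<Rightarrow> ('k, 'k, 'k) tens" where
  "scalars_comult K a = pure K (scalars K) (scalars K) a \<one>\<^bsub>K\<^esub>"

definition tensor_comult ::
    "'k ring \<Rightarrow> ('k, 'c) module \<Rightarrow> ('c \<Rightarrow> ('k, 'c, 'c) tens)
      \<Rightarrow> ('k, 'd) module \<Rightarrow> ('d \<Rightarrow> ('k, 'd, 'd) tens)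
      \<Rightarrow> ('k, 'c, 'd) tens \<Rightarrow> ('k, ('k, 'c, 'd) tens, ('k, 'c, 'd) tens) tens" where
  "tensor_comult K C \<Delta> D \<Delta>' t =
     (let T = tensor K C D; TT = tensor K T T in
       lift K TT t (\<lambda>c d.
         lift K TT (\<Delta> c) (\<lambda>c1 c2.
           lift K TT (\<Delta>' d) (\<lambda>d1 d2. pure K T T (pure K C D c1 d1) (pure K C D c2 d2)))))"

definition tensor_counit ::
    "'k ring \<Rightarrow> ('c \<Rightarrow> 'k) \<Rightarrow> ('d \<Rightarrow> 'k) \<Rightarrow> ('k, 'c, 'd) tens \<Rightarrow> 'k" where
  "tensor_counit K \<epsilon> \<epsilon>' t = lift K (scalars K) t (\<lambda>c d. \<epsilon> c \<otimes>\<^bsub>K\<^esub> \<epsilon>' d)"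

definition comodule ::
    "'k ring \<Rightarrow> ('k, 'c) module \<Rightarrow> ('c \<Rightarrow> ('k, 'c, 'c) tens) \<Rightarrow> ('c \<Rightarrow> 'k)
      \<Rightarrow> ('k, 'm) module \<Rightarrow> ('m \<Rightarrow> ('k, 'c, 'm) tens) \<Rightarrow> bool" where
  "comodule K C \<Delta> \<epsilon> M \<rho> \<longleftrightarrow>
     linear_map K M (tensor K C M) \<rho> \<and>
     (\<forall>m\<in>carrier M.
        tensor_assoc K C C M (tensor_map K (tensor K C C) M \<Delta> (\<lambda>x. x) (\<rho> m))
          = tensor_map K C (tensor K C M) (\<lambda>x. x) \<rho> (\<rho> m) \<and>
        lift K M (\<rho> m) (\<lambda>c x. \<epsilon> c \<odot>\<^bsub>M\<^esub> x) = m)"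


section \<open>Quasigroups\<close>

definition is_qinv :: "'q monoid \<Rightarrow> 'q \<Rightarrow> 'q \<Rightarrow> bool" where
  "is_qinv Q p r \<longleftrightarrow> r \<in> carrier Q \<and>
     (\<forall>q\<in>carrier Q. r \<otimes>\<^bsub>Q\<^esub> (p \<otimes>\<^bsub>Q\<^esub> q) = q \<and> (q \<otimes>\<^bsub>Q\<^esub> p) \<otimes>\<^bsub>Q\<^esub> r = q)"

definition quasigroup :: "'q monoid \<Rightarrow> bool" where
  "quasigroup Q \<longleftrightarrow>
     (\<forall>p\<in>carrier Q. \<forall>q\<in>carrier Q. p \<otimes>\<^bsub>Q\<^esub> q \<in> carrier Q) \<and>
     \<one>\<^bsub>Q\<^esub> \<in> carrier Q \<and>
     (\<forall>p\<in>carrier Q. \<one>\<^bsub>Q\<^esub> \<otimes>\<^bsub>Q\<^esub> p = p \<and> p \<otimes>\<^bsub>Q\<^esub> \<one>\<^bsub>Q\<^esub> = p) \<and>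
     (\<forall>p\<in>carrier Q. \<exists>r. is_qinv Q p r)"

definition qinv :: "'q monoid \<Rightarrow> 'q \<Rightarrow> 'q" where
  "qinv Q p = (THE r. is_qinv Q p r)"


section \<open>Graded Hopf quasigroups\<close>

record ('q, 'k, 'h) hopf_data =
  hsp :: "'q \<Rightarrow> ('k, 'h) module"
  hmul :: "'q \<Rightarrow> 'q \<Rightarrow> ('k, 'h, 'h) tens \<Rightarrow> 'h"
  hunit :: "'k \<Rightarrow> 'h"
  hcomul :: "'q \<Rightarrow> 'h \<Rightarrow> ('k, 'h, 'h) tens"
  hcounit :: "'q \<Rightarrow> 'h \<Rightarrow> 'k"
  hanti :: "'q \<Rightarrow> 'h \<Rightarrow> 'h"

definition hprod ::
    "'k ring \<Rightarrow> ('q, 'k, 'h) hopf_data \<Rightarrow> 'q \<Rightarrow> 'q \<Rightarrow> 'h \<Rightarrow> 'h \<Rightarrow> 'h" where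
  "hprod K H p q h g = hmul H p q (pure K (hsp H p) (hsp H q) h g)"

definition hone :: "'k ring \<Rightarrow> ('q, 'k, 'h) hopf_data \<Rightarrow> 'h" where
  "hone K H = hunit H \<one>\<^bsub>K\<^esub>"

text \<open>
  In the antipode axioms all products land in degree \<open>q\<close>, because \<open>p\<^sup>-\<^sup>1(pq) = q = p(p\<^sup>-\<^sup>1q)\<close> and
  \<open>(qp\<^sup>-\<^sup>1)p = q = (qp)p\<^sup>-\<^sup>1\<close> in a quasigroup.
\<close>

definition graded_hopf_quasigroup ::
    "'k ring \<Rightarrow> 'q monoid \<Rightarrow> ('q, 'k, 'h) hopf_data \<Rightarrow> bool" where
  "graded_hopf_quasigroup K Q H \<longleftrightarrow>
     (\<forall>p\<in>carrier Q. module K (hsp H p)) \<and>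
     (\<forall>p\<in>carrier Q. coalgebra K (hsp H p) (hcomul H p) (hcounit H p)) \<and>
     (\<forall>p\<in>carrier Q. \<forall>q\<in>carrier Q.
        coalgebra_map K
          (tensor K (hsp H p) (hsp H q))
          (tensor_comult K (hsp H p) (hcomul H p) (hsp H q) (hcomul H q))
          (tensor_counit K (hcounit H p) (hcounit H q))
          (hsp H (p \<otimes>\<^bsub>Q\<^esub> q)) (hcomul H (p \<otimes>\<^bsub>Q\<^esub> q)) (hcounit H (p \<otimes>\<^bsub>Q\<^esub> q))
          (hmul H p q)) \<and>
     coalgebra_map K (scalars K) (scalars_comult K) (\<lambda>a. a)
       (hsp H \<one>\<^bsub>Q\<^esub>) (hcomul H \<one>\<^bsub>Q\<^esub>) (hcounit H \<one>\<^bsub>Q\<^esub>) (hunit H) \<and>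
     (\<forall>p\<in>carrier Q. \<forall>h\<in>carrier (hsp H p).
        hprod K H p \<one>\<^bsub>Q\<^esub> h (hone K H) = h \<and> hprod K H \<one>\<^bsub>Q\<^esub> p (hone K H) h = h) \<and>
     (\<forall>p\<in>carrier Q. linear_map K (hsp H p) (hsp H (qinv Q p)) (hanti H p)) \<and>
     (\<forall>p\<in>carrier Q. \<forall>q\<in>carrier Q. \<forall>h\<in>carrier (hsp H p). \<forall>g\<in>carrier (hsp H q).
        lift K (hsp H q) (hcomul H p h) (\<lambda>h1 h2.
            hprod K H (qinv Q p) (p \<otimes>\<^bsub>Q\<^esub> q) (hanti H p h1) (hprod K H p q h2 g))
          = hcounit H p h \<odot>\<^bsub>hsp H q\<^esub> g \<and>
        lift K (hsp H q) (hcomul H p h) (\<lambda>h1 h2.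
            hprod K H p (qinv Q p \<otimes>\<^bsub>Q\<^esub> q) h1 (hprod K H (qinv Q p) q (hanti H p h2) g))
          = hcounit H p h \<odot>\<^bsub>hsp H q\<^esub> g \<and>
        lift K (hsp H q) (hcomul H p h) (\<lambda>h1 h2.
            hprod K H (q \<otimes>\<^bsub>Q\<^esub> qinv Q p) p (hprod K H q (qinv Q p) g (hanti H p h1)) h2)
          = hcounit H p h \<odot>\<^bsub>hsp H q\<^esub> g \<and>
        lift K (hsp H q) (hcomul H p h) (\<lambda>h1 h2.
            hprod K H (q \<otimes>\<^bsub>Q\<^esub> p) (qinv Q p) (hprod K H q p g h1) (hanti H p h2))
          = hcounit H p h \<odot>\<^bsub>hsp H q\<^esub> g)"


section \<open>Graded quasimodules and Hopf quasimodules\<close>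

record ('q, 'k, 'h, 'm) quasimod_data =
  msp :: "'q \<Rightarrow> ('k, 'm) module"
  mact :: "'q \<Rightarrow> 'q \<Rightarrow> ('k, 'h, 'm) tens \<Rightarrow> 'm"

record ('q, 'k, 'h, 'm) hopf_quasimod_data = "('q, 'k, 'h, 'm) quasimod_data" +
  mcoact :: "'q \<Rightarrow> 'm \<Rightarrow> ('k, 'h, 'm) tens"

definition act ::
    "'k ring \<Rightarrow> ('q, 'k, 'h) hopf_data \<Rightarrow> ('q, 'k, 'h, 'm, 'z) quasimod_data_scheme
      \<Rightarrow> 'q \<Rightarrow> 'q \<Rightarrow> 'h \<Rightarrow> 'm \<Rightarrow> 'm" where
  "act K H M p q h m = mact M p q (pure K (hsp H p) (msp M q) h m)"

text \<open>\<open>h\<^sub>(\<^sub>1\<^sub>) \<cdot> (S\<^sub>p(h\<^sub>(\<^sub>2\<^sub>)) \<cdot> m)\<close> and \<open>S\<^sub>p(h\<^sub>(\<^sub>1\<^sub>)) \<cdot> (h\<^sub>(\<^sub>2\<^sub>) \<cdot> m)\<close>, in degree \<open>p(p\<^sup>-\<^sup>1q) = q = p\<^sup>-\<^sup>1(pq)\<close>.\<close>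

definition act_anti_right ::
    "'k ring \<Rightarrow> 'q monoid \<Rightarrow> ('q, 'k, 'h) hopf_data \<Rightarrow> ('q, 'k, 'h, 'm, 'z) quasimod_data_scheme
      \<Rightarrow> 'q \<Rightarrow> 'q \<Rightarrow> 'h \<Rightarrow> 'm \<Rightarrow> 'm" where
  "act_anti_right K Q H M p q h m =
     lift K (msp M q) (hcomul H p h) (\<lambda>h1 h2.
       act K H M p (qinv Q p \<otimes>\<^bsub>Q\<^esub> q) h1 (act K H M (qinv Q p) q (hanti H p h2) m))"

definition act_anti_left ::
    "'k ring \<Rightarrow> 'q monoid \<Rightarrow> ('q, 'k, 'h) hopf_data \<Rightarrow> ('q, 'k, 'h, 'm, 'z) quasimod_data_scheme
      \<Rightarrow> 'q \<Rightarrow> 'q \<Rightarrow> 'h \<Rightarrow> 'm \<Rightarrow> 'm" where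
  "act_anti_left K Q H M p q h m =
     lift K (msp M q) (hcomul H p h) (\<lambda>h1 h2.
       act K H M (qinv Q p) (p \<otimes>\<^bsub>Q\<^esub> q) (hanti H p h1) (act K H M p q h2 m))"

definition graded_quasimodule ::
    "'k ring \<Rightarrow> 'q monoid \<Rightarrow> ('q, 'k, 'h) hopf_data \<Rightarrow> ('q, 'k, 'h, 'm, 'z) quasimod_data_scheme
      \<Rightarrow> bool" where
  "graded_quasimodule K Q H M \<longleftrightarrow>
     (\<forall>q\<in>carrier Q. module K (msp M q)) \<and>
     (\<forall>p\<in>carrier Q. \<forall>q\<in>carrier Q.
        linear_map K (tensor K (hsp H p) (msp M q)) (msp M (p \<otimes>\<^bsub>Q\<^esub> q)) (mact M p q)) \<and>
     (\<forall>q\<in>carrier Q. \<forall>m\<in>carrier (msp M q). act K H M \<one>\<^bsub>Q\<^esub> q (hone K H) m = m) \<and>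
     (\<forall>p\<in>carrier Q. \<forall>q\<in>carrier Q. \<forall>h\<in>carrier (hsp H p). \<forall>m\<in>carrier (msp M q).
        act_anti_right K Q H M p q h m = hcounit H p h \<odot>\<^bsub>msp M q\<^esub> m \<and>
        act_anti_left K Q H M p q h m = hcounit H p h \<odot>\<^bsub>msp M q\<^esub> m)"

definition graded_quasimodule_map ::
    "'k ring \<Rightarrow> 'q monoid \<Rightarrow> ('q, 'k, 'h) hopf_data
      \<Rightarrow> ('q, 'k, 'h, 'm, 'y) quasimod_data_scheme \<Rightarrow> ('q, 'k, 'h, 'n, 'z) quasimod_data_scheme
      \<Rightarrow> ('q \<Rightarrow> 'm \<Rightarrow> 'n) \<Rightarrow> bool" where
  "graded_quasimodule_map K Q H M N f \<longleftrightarrow>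
     (\<forall>q\<in>carrier Q. linear_map K (msp M q) (msp N q) (f q)) \<and>
     (\<forall>p\<in>carrier Q. \<forall>q\<in>carrier Q. \<forall>h\<in>carrier (hsp H p). \<forall>m\<in>carrier (msp M q).
        f q (act_anti_right K Q H M p q h m) = act_anti_right K Q H N p q h (f q m))"

definition graded_hopf_quasimodule ::
    "'k ring \<Rightarrow> 'q monoid \<Rightarrow> ('q, 'k, 'h) hopf_data \<Rightarrow> ('q, 'k, 'h, 'm) hopf_quasimod_data
      \<Rightarrow> bool" where
  "graded_hopf_quasimodule K Q H M \<longleftrightarrow>
     graded_quasimodule K Q H M \<and>
     (\<forall>q\<in>carrier Q.
        comodule K (hsp H q) (hcomul H q) (hcounit H q) (msp M q) (mcoact M q)) \<and>
     (\<forall>p\<in>carrier Q. \<forall>q\<in>carrier Q. \<forall>h\<in>carrier (hsp H p). \<forall>m\<in>carrier (msp M q).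
        mcoact M (p \<otimes>\<^bsub>Q\<^esub> q) (act K H M p q h m) =
          (let V = hsp H (p \<otimes>\<^bsub>Q\<^esub> q); W = msp M (p \<otimes>\<^bsub>Q\<^esub> q) in
            lift K (tensor K V W) (hcomul H p h) (\<lambda>h1 h2.
              lift K (tensor K V W) (mcoact M q m) (\<lambda>m1 m0.
                pure K V W (hprod K H p q h1 m1) (act K H M p q h2 m0)))))"

definition graded_hopf_quasimodule_map ::
    "'k ring \<Rightarrow> 'q monoid \<Rightarrow> ('q, 'k, 'h) hopf_data
      \<Rightarrow> ('q, 'k, 'h, 'm) hopf_quasimod_data \<Rightarrow> ('q, 'k, 'h, 'n) hopf_quasimod_data
      \<Rightarrow> ('q \<Rightarrow> 'm \<Rightarrow> 'n) \<Rightarrow> bool" where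
  "graded_hopf_quasimodule_map K Q H M N f \<longleftrightarrow>
     graded_quasimodule_map K Q H M N f \<and>
     (\<forall>q\<in>carrier Q. \<forall>m\<in>carrier (msp M q).
        tensor_map K (hsp H q) (msp N q) (\<lambda>x. x) (f q) (mcoact M q m) = mcoact N q (f q m))"

definition graded_hopf_quasimodule_iso ::
    "'k ring \<Rightarrow> 'q monoid \<Rightarrow> ('q, 'k, 'h) hopf_data
      \<Rightarrow> ('q, 'k, 'h, 'm) hopf_quasimod_data \<Rightarrow> ('q, 'k, 'h, 'n) hopf_quasimod_data
      \<Rightarrow> ('q \<Rightarrow> 'm \<Rightarrow> 'n) \<Rightarrow> bool" where
  "graded_hopf_quasimodule_iso K Q H M N f \<longleftrightarrow>
     graded_hopf_quasimodule_map K Q H M N f \<and>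
     (\<forall>q\<in>carrier Q. bij_betw (f q) (carrier (msp M q)) (carrier (msp N q)))"

definition coinvariants ::
    "'k ring \<Rightarrow> 'q monoid \<Rightarrow> ('q, 'k, 'h) hopf_data \<Rightarrow> ('q, 'k, 'h, 'm) hopf_quasimod_data
      \<Rightarrow> ('k, 'm) module" where
  "coinvariants K Q H M =
     (msp M \<one>\<^bsub>Q\<^esub>)\<lparr>carrier := {m \<in> carrier (msp M \<one>\<^bsub>Q\<^esub>).
        mcoact M \<one>\<^bsub>Q\<^esub> m = pure K (hsp H \<one>\<^bsub>Q\<^esub>) (msp M \<one>\<^bsub>Q\<^esub>) (hone K H) m}\<rparr>"

text \<open>
  The family \<open>{H\<^sub>q \<otimes> V}\<close> for a vector space \<open>V\<close>, with action \<open>h \<cdot> (g \<otimes> v) = hg \<otimes> v\<close> and coaction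
  \<open>g \<otimes> v \<mapsto> g\<^sub>(\<^sub>1\<^sub>) \<otimes> (g\<^sub>(\<^sub>2\<^sub>) \<otimes> v)\<close>.
\<close>

definition free_hopf_quasimodule ::
    "'k ring \<Rightarrow> 'q monoid \<Rightarrow> ('q, 'k, 'h) hopf_data \<Rightarrow> ('k, 'v) module
      \<Rightarrow> ('q, 'k, 'h, ('k, 'h, 'v) tens) hopf_quasimod_data" where
  "free_hopf_quasimodule K Q H V =
     \<lparr>msp = (\<lambda>q. tensor K (hsp H q) V),
      mact = (\<lambda>p q t.
        let Z = tensor K (hsp H (p \<otimes>\<^bsub>Q\<^esub> q)) V in
          lift K Z t (\<lambda>h s. lift K Z s (\<lambda>g v.
            pure K (hsp H (p \<otimes>\<^bsub>Q\<^esub> q)) V (hprod K H p q h g) v))),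
      mcoact = (\<lambda>q t.
        let T = tensor K (hsp H q) V; Z = tensor K (hsp H q) T in
          lift K Z t (\<lambda>g v. lift K Z (hcomul H q g) (\<lambda>g1 g2.
            pure K (hsp H q) T g1 (pure K (hsp H q) V g2 v))))\<rparr>"

end

theory Submission
  imports Defs
begin

text \<open>
  The isomorphism sends \<open>h \<otimes> m\<close> to \<open>h \<cdot> m\<close>, with inverse \<open>m \<mapsto> m\<^sub>(\<^sub>-\<^sub>1\<^sub>) \<otimes> E(m\<^sub>(\<^sub>0\<^sub>))\<close>, where
  \<open>E(m) = S(m\<^sub>(\<^sub>-\<^sub>1\<^sub>)) \<cdot> m\<^sub>(\<^sub>0\<^sub>)\<close> lies in degree \<open>q\<^sup>-\<^sup>1q = e\<close> for \<open>m\<close> of degree \<open>q\<close>. The two quasimodule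
  axioms and coassociativity give \<open>m\<^sub>(\<^sub>-\<^sub>1\<^sub>) \<cdot> E(m\<^sub>(\<^sub>0\<^sub>)) = m\<close>, and \<open>E(h \<cdot> m) = \<epsilon>(h)m\<close> for coinvariant \<open>m\<close>; the
  main point is that \<open>E(m)\<close> is coinvariant. Since both sides of the quasimodule map condition equal
  \<open>\<epsilon>(h)f(m)\<close>, that condition is automatic for a linear map between quasimodules.
\<close>

section \<open>Linear and bilinear maps\<close>

text \<open>The obstacle is the coaction of S(h) \<cdot> m: by the compatibility axiom it involves
  the comultiplication of S(h), which the axioms do not describe. Moreover, products in H and
  iterated actions cannot be reassociated; an antipode disappears only in nested patterns such as
  S(h1)(h2 g) and S(h1) \<cdot> (h2 \<cdot> m). The identity m = m(-1) \<cdot> E(m(0)) is proved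
  without coinvariance of E, so it may be substituted inside a larger sum. The substitution supplies
  exactly the missing inner factors: the sum then contains S(h2)(g1 a) in one tensor leg and S(h1)
  \<cdot> (g2 \<cdot> b) in the other, where a \<otimes> b is the coaction of a value of E, and both
  patterns cancel. Formally every Sweedler sum is a \<open>lift\<close>, evaluated on a chosen
  representative. It behaves well only for bilinear arguments, so each rewriting inside a sum
  carries linearity obligations; most of the auxiliary rules serve to discharge them by backward
  resolution. All components of H share one element type, and so do those of M, so changing between
  equal degrees needs only an equation in Q.\<close>

definition bilinear_map ::
    "'k ring \<Rightarrow> ('k, 'a) module \<Rightarrow> ('k, 'b) module \<Rightarrow> ('k, 'c) module \<Rightarrow> ('a \<Rightarrow> 'b \<Rightarrow> 'c) \<Rightarrow> bool" where
  "bilinear_map K V W Z B \<longleftrightarrow>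
     (\<forall>v\<in>carrier V. linear_map K W Z (\<lambda>w. B v w)) \<and> (\<forall>w\<in>carrier W. linear_map K V Z (\<lambda>v. B v w))"

lemma linear_mapI:
  assumes "\<And>x. x \<in> carrier V \<Longrightarrow> f x \<in> carrier W"
    and "\<And>x y. x \<in> carrier V \<Longrightarrow> y \<in> carrier V \<Longrightarrow> f (x \<oplus>\<^bsub>V\<^esub> y) = f x \<oplus>\<^bsub>W\<^esub> f y"
    and "\<And>a x. a \<in> carrier K \<Longrightarrow> x \<in> carrier V \<Longrightarrow> f (a \<odot>\<^bsub>V\<^esub> x) = a \<odot>\<^bsub>W\<^esub> f x"
  shows "linear_map K V W f"
  using assms by (auto simp: linear_map_def)

lemma linear_map_closed: "linear_map K V W f \<Longrightarrow> x \<in> carrier V \<Longrightarrow> f x \<in> carrier W"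
  by (auto simp: linear_map_def)

lemma linear_map_add:
  "linear_map K V W f \<Longrightarrow> x \<in> carrier V \<Longrightarrow> y \<in> carrier V \<Longrightarrow> f (x \<oplus>\<^bsub>V\<^esub> y) = f x \<oplus>\<^bsub>W\<^esub> f y"
  by (auto simp: linear_map_def)

lemma linear_map_smult:
  "linear_map K V W f \<Longrightarrow> a \<in> carrier K \<Longrightarrow> x \<in> carrier V \<Longrightarrow> f (a \<odot>\<^bsub>V\<^esub> x) = a \<odot>\<^bsub>W\<^esub> f x"
  by (auto simp: linear_map_def)

lemma linear_map_zero:
  assumes "module K V" "module K W" "linear_map K V W f"
  shows "f \<zero>\<^bsub>V\<^esub> = \<zero>\<^bsub>W\<^esub>"
proof -
  interpret V: module K V by fact
  interpret W: module K W by fact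
  have "f \<zero>\<^bsub>V\<^esub> = f (\<zero>\<^bsub>K\<^esub> \<odot>\<^bsub>V\<^esub> \<zero>\<^bsub>V\<^esub>)" by simp
  also have "\<dots> = \<zero>\<^bsub>K\<^esub> \<odot>\<^bsub>W\<^esub> f \<zero>\<^bsub>V\<^esub>"
    by (rule linear_map_smult[OF assms(3)]) auto
  also have "\<dots> = \<zero>\<^bsub>W\<^esub>" using linear_map_closed[OF assms(3)] by simp
  finally show ?thesis .
qed

lemma linear_map_minus:
  assumes "module K V" "module K W" "linear_map K V W f" "x \<in> carrier V" "y \<in> carrier V"
  shows "f (x \<ominus>\<^bsub>V\<^esub> y) = f x \<ominus>\<^bsub>W\<^esub> f y"
proof -
  interpret V: module K V by fact
  interpret W: module K W by fact
  have 1: "x \<ominus>\<^bsub>V\<^esub> y = x \<oplus>\<^bsub>V\<^esub> (\<ominus>\<^bsub>K\<^esub> \<one>\<^bsub>K\<^esub>) \<odot>\<^bsub>V\<^esub> y"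
    using assms(5) by (simp add: V.smult_l_minus V.minus_eq)
  have "f y \<in> carrier W" by (rule linear_map_closed[OF assms(3,5)])
  then have 2: "f x \<ominus>\<^bsub>W\<^esub> f y = f x \<oplus>\<^bsub>W\<^esub> (\<ominus>\<^bsub>K\<^esub> \<one>\<^bsub>K\<^esub>) \<odot>\<^bsub>W\<^esub> f y"
    by (simp add: W.smult_l_minus W.minus_eq)
  have m: "\<ominus>\<^bsub>K\<^esub> \<one>\<^bsub>K\<^esub> \<in> carrier K" by simp
  show ?thesis
    unfolding 1 2 linear_map_smult[OF assms(3) m assms(5), symmetric]
    by (rule linear_map_add[OF assms(3,4) V.smult_closed[OF m assms(5)]])
qed

lemma linear_map_id: "linear_map K V V (\<lambda>x. x)"
  by (auto simp: linear_map_def)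

lemma linear_map_comp:
  "linear_map K V W f \<Longrightarrow> linear_map K U V g \<Longrightarrow> linear_map K U W (\<lambda>x. f (g x))"
  by (auto simp: linear_map_def Pi_def)

lemma linear_map_cong:
  assumes "module K V" "\<And>x. x \<in> carrier V \<Longrightarrow> f x = g x"
  shows "linear_map K V W f \<longleftrightarrow> linear_map K V W g"
proof -
  interpret module K V by fact
  show ?thesis using assms(2) by (auto simp: linear_map_def Pi_def)
qed

lemma bilinear_mapI:
  assumes "\<And>v. v \<in> carrier V \<Longrightarrow> linear_map K W Z (\<lambda>w. B v w)"
    and "\<And>w. w \<in> carrier W \<Longrightarrow> linear_map K V Z (\<lambda>v. B v w)"
  shows "bilinear_map K V W Z B"
  using assms by (auto simp: bilinear_map_def)

text \<open>The inner linear map \<open>f\<close> makes this usable as an introduction rule for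
  compound arguments; with \<open>f\<close> the identity it is linearity in the first
  variable.\<close>

lemma bilinear_map_left:
  "bilinear_map K V W Z B \<Longrightarrow> linear_map K U V f \<Longrightarrow> w \<in> carrier W \<Longrightarrow> linear_map K U Z (\<lambda>u. B (f u) w)"
  unfolding bilinear_map_def by (blast intro: linear_map_comp[of K V Z "\<lambda>v. B v w"])

lemma bilinear_map_right:
  "bilinear_map K V W Z B \<Longrightarrow> linear_map K U W f \<Longrightarrow> v \<in> carrier V \<Longrightarrow> linear_map K U Z (\<lambda>u. B v (f u))"
  unfolding bilinear_map_def by (blast intro: linear_map_comp[of K W Z "B v"])

lemma bilinear_map_closed:
  "bilinear_map K V W Z B \<Longrightarrow> v \<in> carrier V \<Longrightarrow> w \<in> carrier W \<Longrightarrow> B v w \<in> carrier Z"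
  unfolding bilinear_map_def by (blast dest: linear_map_closed)

lemma linear_map_add_fun:
  assumes "module K W" "linear_map K V W f" "linear_map K V W g"
  shows "linear_map K V W (\<lambda>x. f x \<oplus>\<^bsub>W\<^esub> g x)"
proof -
  interpret W: module K W by fact
  note c = linear_map_closed[OF assms(2)] linear_map_closed[OF assms(3)]
  show ?thesis
    by (rule linear_mapI)
      (simp_all add: c linear_map_add[OF assms(2)] linear_map_add[OF assms(3)]
        linear_map_smult[OF assms(2)] linear_map_smult[OF assms(3)] W.a_ac W.smult_r_distr)
qed

lemma linear_map_smult_fun:
  assumes "module K W" "linear_map K V W f" "a \<in> carrier K"
  shows "linear_map K V W (\<lambda>x. a \<odot>\<^bsub>W\<^esub> f x)"
proof -
  interpret W: module K W by fact
  note c = linear_map_closed[OF assms(2)]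
  have com: "b \<in> carrier K \<Longrightarrow> w \<in> carrier W \<Longrightarrow> a \<odot>\<^bsub>W\<^esub> (b \<odot>\<^bsub>W\<^esub> w) = b \<odot>\<^bsub>W\<^esub> (a \<odot>\<^bsub>W\<^esub> w)" for b w
    using assms(3) by (simp add: W.smult_assoc1[symmetric] W.R.m_comm)
  show ?thesis
    by (rule linear_mapI)
      (simp_all add: assms(3) c linear_map_add[OF assms(2)] linear_map_smult[OF assms(2)] W.smult_r_distr com)
qed

lemma linear_map_scalars:
  assumes "module K W" "linear_map K V (scalars K) f" "w \<in> carrier W"
  shows "linear_map K V W (\<lambda>x. f x \<odot>\<^bsub>W\<^esub> w)"
proof -
  interpret W: module K W by fact
  have c: "x \<in> carrier V \<Longrightarrow> f x \<in> carrier K" for x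
    using linear_map_closed[OF assms(2)] by (simp add: scalars_def)
  show ?thesis
    by (rule linear_mapI)
      (simp_all add: assms(3) c linear_map_add[OF assms(2)] linear_map_smult[OF assms(2)] W.smult_l_distr
         W.smult_assoc1 scalars_def)
qed

section \<open>Quotient modules\<close>

locale quotient_by_submodule = F: module K F + N: submodule N K F for K :: "'k ring" and F :: "('k, 'a) module" and N
begin

sublocale abelian_subgroup N F
  by (rule abelian_subgroupI3)
    (auto intro: additive_subgroup.intro N.subgroup_axioms F.abelian_group_axioms)

lemma quotient_carrier: "C \<in> carrier (quotient_module F N) \<longleftrightarrow> (\<exists>x\<in>carrier F. C = N +>\<^bsub>F\<^esub> x)"
  by (auto simp: quotient_module_def A_RCOSETS_def')

lemma quotient_add:
  "x \<in> carrier F \<Longrightarrow> y \<in> carrier F \<Longrightarrow>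
    (N +>\<^bsub>F\<^esub> x) \<oplus>\<^bsub>quotient_module F N\<^esub> (N +>\<^bsub>F\<^esub> y) = N +>\<^bsub>F\<^esub> (x \<oplus>\<^bsub>F\<^esub> y)"
  by (simp add: quotient_module_def a_rcos_sum)

lemma quotient_zero: "\<zero>\<^bsub>quotient_module F N\<^esub> = N +>\<^bsub>F\<^esub> \<zero>\<^bsub>F\<^esub>"
  by (simp add: quotient_module_def F.a_coset_add_zero a_subset)

text \<open>Adding \<open>N\<close> in the definition of the scalar multiple matters when
  \<open>a\<close> is zero: the image of a coset is then only the zero vector, and the sum with
  \<open>N\<close> restores a full coset.\<close>

lemma quotient_smult:
  assumes a: "a \<in> carrier K" and x: "x \<in> carrier F"
  shows "a \<odot>\<^bsub>quotient_module F N\<^esub> (N +>\<^bsub>F\<^esub> x) = N +>\<^bsub>F\<^esub> (a \<odot>\<^bsub>F\<^esub> x)"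
proof -
  have sub: "n \<in> N \<Longrightarrow> n \<in> carrier F" for n using a_subset by blast
  have "((\<lambda>x. a \<odot>\<^bsub>F\<^esub> x) ` (N +>\<^bsub>F\<^esub> x)) <+>\<^bsub>F\<^esub> N = N +>\<^bsub>F\<^esub> (a \<odot>\<^bsub>F\<^esub> x)" (is "?L = ?R")
  proof (intro equalityI subsetI)
    fix y assume "y \<in> ?L"
    then obtain n n' where n: "n \<in> N" "n' \<in> N" and y: "y = a \<odot>\<^bsub>F\<^esub> (n \<oplus>\<^bsub>F\<^esub> x) \<oplus>\<^bsub>F\<^esub> n'"
      by (auto simp: set_add_def' a_r_coset_def')
    have "y = (a \<odot>\<^bsub>F\<^esub> n \<oplus>\<^bsub>F\<^esub> n') \<oplus>\<^bsub>F\<^esub> a \<odot>\<^bsub>F\<^esub> x"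
      using n a x sub by (simp add: y F.smult_r_distr F.a_ac)
    moreover have "a \<odot>\<^bsub>F\<^esub> n \<oplus>\<^bsub>F\<^esub> n' \<in> N" using n a by simp
    ultimately show "y \<in> ?R" by (auto simp: a_r_coset_def')
  next
    fix y assume "y \<in> ?R"
    then obtain n where n: "n \<in> N" and y: "y = n \<oplus>\<^bsub>F\<^esub> a \<odot>\<^bsub>F\<^esub> x" by (auto simp: a_r_coset_def')
    have "y = a \<odot>\<^bsub>F\<^esub> (\<zero>\<^bsub>F\<^esub> \<oplus>\<^bsub>F\<^esub> x) \<oplus>\<^bsub>F\<^esub> n"
      using n a x sub by (simp add: y F.a_ac)
    then show "y \<in> ?L" using n zero_closed by (auto simp: set_add_def' a_r_coset_def')
  qed
  then show ?thesis by (simp add: quotient_module_def)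
qed

lemmas quotient_simps = quotient_add quotient_smult quotient_zero

lemma module_quotient: "module K (quotient_module F N)"
proof (rule moduleI)
  show "cring K" by (rule F.R.is_cring)
  show "abelian_group (quotient_module F N)"
  proof (rule abelian_groupI)
    fix C assume "C \<in> carrier (quotient_module F N)"
    then obtain x where x: "x \<in> carrier F" "C = N +>\<^bsub>F\<^esub> x" by (auto simp: quotient_carrier)
    then have "(N +>\<^bsub>F\<^esub> (\<ominus>\<^bsub>F\<^esub> x)) \<oplus>\<^bsub>quotient_module F N\<^esub> C = \<zero>\<^bsub>quotient_module F N\<^esub>"
      by (simp add: quotient_simps F.l_neg)
    moreover have "N +>\<^bsub>F\<^esub> (\<ominus>\<^bsub>F\<^esub> x) \<in> carrier (quotient_module F N)"
      using x by (auto simp: quotient_carrier)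
    ultimately show "\<exists>y\<in>carrier (quotient_module F N).
        y \<oplus>\<^bsub>quotient_module F N\<^esub> C = \<zero>\<^bsub>quotient_module F N\<^esub>" by blast
  qed (auto simp: quotient_carrier quotient_simps F.a_ac)
qed (auto simp: quotient_carrier quotient_simps F.smult_l_distr F.smult_r_distr F.smult_assoc1)

end

section \<open>Free modules\<close>

text \<open>The linear extension of \<open>b\<close> to the free module. The sum has the same shape
  as the one in \<open>lift\<close>, so \<open>lift\<close> becomes \<open>free_eval\<close> at the
  chosen representative.\<close>

definition free_eval :: "'k ring \<Rightarrow> ('k, 'z) module \<Rightarrow> ('x \<Rightarrow> 'z) \<Rightarrow> ('x \<Rightarrow> 'k) \<Rightarrow> 'z" where
  "free_eval K Z b c = (\<Oplus>\<^bsub>Z\<^esub> x \<in> {x. c x \<noteq> \<zero>\<^bsub>K\<^esub>}. c x \<odot>\<^bsub>Z\<^esub> b x)"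

lemma free_module_carrier:
  "c \<in> carrier (free_module K X) \<longleftrightarrow>
    (\<forall>x. c x \<in> carrier K) \<and> finite {x. c x \<noteq> \<zero>\<^bsub>K\<^esub>} \<and> (\<forall>x. x \<notin> X \<longrightarrow> c x = \<zero>\<^bsub>K\<^esub>)"
  by (auto simp: free_module_def)

lemma free_module_ops:
  "(c \<oplus>\<^bsub>free_module K X\<^esub> d) x = c x \<oplus>\<^bsub>K\<^esub> d x"
  "(a \<odot>\<^bsub>free_module K X\<^esub> c) x = a \<otimes>\<^bsub>K\<^esub> c x"
  "\<zero>\<^bsub>free_module K X\<^esub> x = \<zero>\<^bsub>K\<^esub>"
  by (simp_all add: free_module_def)

lemma module_free_module:
  assumes "cring K" shows "module K (free_module K X)"
proof -
  interpret cring K by fact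
  have fin: "finite {x. c x \<oplus>\<^bsub>K\<^esub> d x \<noteq> \<zero>\<^bsub>K\<^esub>}"
    if "finite {x. c x \<noteq> \<zero>\<^bsub>K\<^esub>}" "finite {x. d x \<noteq> \<zero>\<^bsub>K\<^esub>}" for c d :: "'c \<Rightarrow> _"
    by (rule finite_subset[of _ "{x. c x \<noteq> \<zero>\<^bsub>K\<^esub>} \<union> {x. d x \<noteq> \<zero>\<^bsub>K\<^esub>}"]) (use that in auto)
  have fins: "finite {x. a \<otimes>\<^bsub>K\<^esub> c x \<noteq> \<zero>\<^bsub>K\<^esub>}"
    if "finite {x. c x \<noteq> \<zero>\<^bsub>K\<^esub>}" "a \<in> carrier K" for a and c :: "'c \<Rightarrow> _"
    by (rule finite_subset[of _ "{x. c x \<noteq> \<zero>\<^bsub>K\<^esub>}"]) (use that in auto)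
  show ?thesis
  proof (rule moduleI)
    show "abelian_group (free_module K X)"
    proof (rule abelian_groupI)
      fix c assume c: "c \<in> carrier (free_module K X)"
      have "finite {x. \<ominus>\<^bsub>K\<^esub> c x \<noteq> \<zero>\<^bsub>K\<^esub>}"
        by (rule finite_subset[of _ "{x. c x \<noteq> \<zero>\<^bsub>K\<^esub>}"]) (use c in \<open>auto simp: free_module_carrier\<close>)
      then have "(\<lambda>x. \<ominus>\<^bsub>K\<^esub> c x) \<in> carrier (free_module K X)"
        using c by (simp add: free_module_carrier)
      moreover have "(\<lambda>x. \<ominus>\<^bsub>K\<^esub> c x) \<oplus>\<^bsub>free_module K X\<^esub> c = \<zero>\<^bsub>free_module K X\<^esub>"
        using c by (simp add: fun_eq_iff free_module_carrier free_module_ops l_neg)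
      ultimately show "\<exists>y\<in>carrier (free_module K X). y \<oplus>\<^bsub>free_module K X\<^esub> c = \<zero>\<^bsub>free_module K X\<^esub>"
        by blast
    qed (simp_all add: fun_eq_iff free_module_carrier free_module_ops fin a_ac)
  qed (simp_all add: is_cring fun_eq_iff free_module_carrier free_module_ops fins l_distr r_distr m_assoc)
qed

lemma free_basis_closed:
  assumes "cring K" "x \<in> X" shows "free_basis K x \<in> carrier (free_module K X)"
proof -
  interpret cring K by fact
  have "{y. free_basis K x y \<noteq> \<zero>\<^bsub>K\<^esub>} \<subseteq> {x}" by (auto simp: free_basis_def)
  then show ?thesis
    using assms(2) finite_subset[of _ "{x}"] by (auto simp: free_module_def free_basis_def)
qed

text \<open>Supports change under addition and scaling. Summing over a larger finite index set only
  adds zero terms, so different coefficient functions can be compared over a common set.\<close>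

lemma free_eval_superset:
  assumes "module K Z" "c \<in> carrier (free_module K X)" "b \<in> X \<rightarrow> carrier Z"
    and "finite A" "{x. c x \<noteq> \<zero>\<^bsub>K\<^esub>} \<subseteq> A" "A \<subseteq> X"
  shows "free_eval K Z b c = (\<Oplus>\<^bsub>Z\<^esub> x \<in> A. c x \<odot>\<^bsub>Z\<^esub> b x)"
proof -
  interpret Z: module K Z by fact
  have c: "c x \<in> carrier K" for x using assms(2) by (auto simp: free_module_def)
  show ?thesis unfolding free_eval_def
    by (rule Z.add.finprod_mono_neutral_cong_left) (use assms c in \<open>auto simp: Pi_def subset_iff\<close>)
qed

lemma linear_map_free_eval:
  assumes "module K Z" "b \<in> X \<rightarrow> carrier Z"
  shows "linear_map K (free_module K X) Z (free_eval K Z b)"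
proof -
  interpret Z: module K Z by fact
  interpret F: module K "free_module K X" by (rule module_free_module) (rule Z.R.is_cring)
  let ?s = "\<lambda>c. {x. c x \<noteq> \<zero>\<^bsub>K\<^esub>}"
  have D: "c x \<in> carrier K" "finite (?s c)" "?s c \<subseteq> X" if "c \<in> carrier (free_module K X)" for c x
    using that by (auto simp: free_module_def)
  have bX: "x \<in> X \<Longrightarrow> b x \<in> carrier Z" for x using assms(2) by auto
  show ?thesis
  proof (rule linear_mapI)
    fix c assume c: "c \<in> carrier (free_module K X)"
    show "free_eval K Z b c \<in> carrier Z"
      unfolding free_eval_def by (rule Z.finsum_closed) (use D[OF c] assms(2) in auto)
    fix a assume a: "a \<in> carrier K"
    have "free_eval K Z b (a \<odot>\<^bsub>free_module K X\<^esub> c) =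
        (\<Oplus>\<^bsub>Z\<^esub> x \<in> ?s c. (a \<odot>\<^bsub>free_module K X\<^esub> c) x \<odot>\<^bsub>Z\<^esub> b x)"
      by (rule free_eval_superset[OF assms(1) F.smult_closed[OF a c] assms(2)])
        (use D[OF c] a in \<open>auto simp: free_module_def\<close>)
    also have "\<dots> = (\<Oplus>\<^bsub>Z\<^esub> x \<in> ?s c. a \<odot>\<^bsub>Z\<^esub> (c x \<odot>\<^bsub>Z\<^esub> b x))"
      by (rule Z.finsum_cong') (use D[OF c] bX a in \<open>auto simp: free_module_def Z.smult_assoc1\<close>)
    also have "\<dots> = a \<odot>\<^bsub>Z\<^esub> free_eval K Z b c"
      unfolding free_eval_def by (rule Z.finsum_smult_ldistr[symmetric]) (use D[OF c] bX a in auto)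
    finally show "free_eval K Z b (a \<odot>\<^bsub>free_module K X\<^esub> c) = a \<odot>\<^bsub>Z\<^esub> free_eval K Z b c" .
  next
    fix c d assume c: "c \<in> carrier (free_module K X)" and d: "d \<in> carrier (free_module K X)"
    let ?A = "?s c \<union> ?s d"
    have A: "finite ?A" "?A \<subseteq> X" using D c d by auto
    have "free_eval K Z b (c \<oplus>\<^bsub>free_module K X\<^esub> d) =
        (\<Oplus>\<^bsub>Z\<^esub> x \<in> ?A. (c \<oplus>\<^bsub>free_module K X\<^esub> d) x \<odot>\<^bsub>Z\<^esub> b x)"
      by (rule free_eval_superset[OF assms(1) F.a_closed[OF c d] assms(2)])
        (use A in \<open>auto simp: free_module_def\<close>)
    also have "\<dots> = (\<Oplus>\<^bsub>Z\<^esub> x \<in> ?A. c x \<odot>\<^bsub>Z\<^esub> b x \<oplus>\<^bsub>Z\<^esub> d x \<odot>\<^bsub>Z\<^esub> b x)"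
      by (rule Z.finsum_cong') (use A D[OF c] D[OF d] bX in \<open>auto simp: free_module_def Z.smult_l_distr\<close>)
    also have "\<dots> = (\<Oplus>\<^bsub>Z\<^esub> x \<in> ?A. c x \<odot>\<^bsub>Z\<^esub> b x) \<oplus>\<^bsub>Z\<^esub> (\<Oplus>\<^bsub>Z\<^esub> x \<in> ?A. d x \<odot>\<^bsub>Z\<^esub> b x)"
      by (rule Z.finsum_addf) (use D[OF c] D[OF d] bX in auto)
    also have "\<dots> = free_eval K Z b c \<oplus>\<^bsub>Z\<^esub> free_eval K Z b d"
      using A by (simp add: free_eval_superset[OF assms(1) c assms(2), of ?A]
        free_eval_superset[OF assms(1) d assms(2), of ?A])
    finally show "free_eval K Z b (c \<oplus>\<^bsub>free_module K X\<^esub> d) = free_eval K Z b c \<oplus>\<^bsub>Z\<^esub> free_eval K Z b d" .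
  qed
qed

lemma free_eval_basis:
  assumes "module K Z" "b \<in> X \<rightarrow> carrier Z" "x \<in> X"
  shows "free_eval K Z b (free_basis K x) = b x"
proof -
  interpret Z: module K Z by fact
  have "free_eval K Z b (free_basis K x) = (\<Oplus>\<^bsub>Z\<^esub> y \<in> {x}. free_basis K x y \<odot>\<^bsub>Z\<^esub> b y)"
    by (rule free_eval_superset[OF assms(1) free_basis_closed assms(2)])
      (use assms Z.R.is_cring in \<open>auto simp: free_basis_def\<close>)
  also have "\<dots> = b x" using assms by (auto simp: free_basis_def Pi_def)
  finally show ?thesis .
qed

text \<open>Induction on a finite set containing the support: resetting one coordinate to zero
  splits off a multiple of a basis vector and leaves a function supported in the smaller
  set.\<close>

lemma free_module_induct [consumes 2, case_names zero add smult basis]: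
  assumes K: "cring K" and c: "c \<in> carrier (free_module K X)"
    and zero: "P \<zero>\<^bsub>free_module K X\<^esub>"
    and add: "\<And>c d. c \<in> carrier (free_module K X) \<Longrightarrow> d \<in> carrier (free_module K X) \<Longrightarrow> P c \<Longrightarrow> P d
      \<Longrightarrow> P (c \<oplus>\<^bsub>free_module K X\<^esub> d)"
    and smult: "\<And>a c. a \<in> carrier K \<Longrightarrow> c \<in> carrier (free_module K X) \<Longrightarrow> P c
      \<Longrightarrow> P (a \<odot>\<^bsub>free_module K X\<^esub> c)"
    and basis: "\<And>x. x \<in> X \<Longrightarrow> P (free_basis K x)"
  shows "P c"
proof -
  interpret K: cring K by fact
  interpret F: module K "free_module K X" by (rule module_free_module) fact
  have "finite A \<Longrightarrow> c \<in> carrier (free_module K X) \<Longrightarrow> {x. c x \<noteq> \<zero>\<^bsub>K\<^esub>} \<subseteq> A \<Longrightarrow> P c" for A c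
  proof (induction A arbitrary: c rule: finite_induct)
    case empty
    then have "c = \<zero>\<^bsub>free_module K X\<^esub>" by (auto simp: free_module_def)
    then show ?case using zero by simp
  next
    case (insert x A)
    show ?case
    proof (cases "c x = \<zero>\<^bsub>K\<^esub>")
      case True
      then show ?thesis using insert by blast
    next
      case False
      define d where "d = c(x := \<zero>\<^bsub>K\<^esub>)"
      have x: "x \<in> X" and cx: "c x \<in> carrier K" using False insert.prems(1) by (auto simp: free_module_def)
      have sd: "{y. d y \<noteq> \<zero>\<^bsub>K\<^esub>} \<subseteq> {y. c y \<noteq> \<zero>\<^bsub>K\<^esub>}" by (auto simp: d_def)
      then have "finite {y. d y \<noteq> \<zero>\<^bsub>K\<^esub>}"
        using insert.prems(1) finite_subset by (auto simp: free_module_def)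
      then have d: "d \<in> carrier (free_module K X)"
        using insert.prems(1) sd by (auto simp: free_module_def d_def)
      have "c = d \<oplus>\<^bsub>free_module K X\<^esub> (c x \<odot>\<^bsub>free_module K X\<^esub> free_basis K x)"
        using insert.prems(1) cx
        by (auto simp: free_module_carrier free_module_ops free_basis_def d_def fun_eq_iff)
      moreover have "P d" by (rule insert.IH[OF d]) (use insert.prems(2) in \<open>auto simp: d_def\<close>)
      ultimately show ?thesis
        using add d smult[OF cx free_basis_closed[OF K x] basis[OF x]] F.smult_closed[OF cx free_basis_closed[OF K x]]
        by metis
    qed
  qed
  then show ?thesis using c by (auto simp: free_module_def)
qed

section \<open>Tensor products\<close>

lemma submodule_span_properties:
  assumes "module K F" "R \<subseteq> carrier F"
  shows submodule_submodule_span: "submodule (submodule_span K F R) K F"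
    and submodule_span_superset: "R \<subseteq> submodule_span K F R"
    and submodule_span_least: "submodule N K F \<Longrightarrow> R \<subseteq> N \<Longrightarrow> submodule_span K F R \<subseteq> N"
proof -
  interpret F: module K F by fact
  \<comment> \<open>The whole carrier is one of the submodules being intersected, so the family is
    nonempty and the intersection stays inside the carrier.\<close>
  have c: "submodule (carrier F) K F" by (rule F.carrier_is_submodule)
  have *: "N \<subseteq> carrier F \<and> \<zero>\<^bsub>F\<^esub> \<in> N" if "submodule N K F" for N
    using subgroup.subset[OF submodule.axioms(1)[OF that]] subgroup.one_closed[OF submodule.axioms(1)[OF that]]
    by simp
  show "submodule (submodule_span K F R) K F"
    by (rule F.submoduleI) (use * c assms(2) in \<open>auto simp: submodule_span_def F.submoduleE(3-5)\<close>)
  show "R \<subseteq> submodule_span K F R"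
    "submodule N K F \<Longrightarrow> R \<subseteq> N \<Longrightarrow> submodule_span K F R \<subseteq> N"
    by (auto simp: submodule_span_def)
qed

lemma submodule_kernel:
  assumes "module K F" "module K Z" "linear_map K F Z f"
  shows "submodule {x \<in> carrier F. f x = \<zero>\<^bsub>Z\<^esub>} K F"
proof -
  interpret F: module K F by fact
  interpret Z: module K Z by fact
  note z = linear_map_zero[OF assms]
  have neg: "f (\<ominus>\<^bsub>F\<^esub> x) = \<zero>\<^bsub>Z\<^esub>" if "x \<in> carrier F" "f x = \<zero>\<^bsub>Z\<^esub>" for x
    using linear_map_minus[OF assms, of "\<zero>\<^bsub>F\<^esub>" x] that z by (simp add: F.minus_eq Z.minus_eq)
  show ?thesis
    by (rule F.submoduleI) (auto simp: z neg linear_map_add[OF assms(3)] linear_map_smult[OF assms(3)])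
qed

lemma (in quotient_by_submodule) coset_eqI:
  assumes "x \<in> carrier F" "y \<in> carrier F" "x \<ominus>\<^bsub>F\<^esub> y \<in> N"
  shows "N +>\<^bsub>F\<^esub> x = N +>\<^bsub>F\<^esub> y"
proof -
  have "x = (x \<ominus>\<^bsub>F\<^esub> y) \<oplus>\<^bsub>F\<^esub> y" using assms(1,2) by (simp add: F.minus_eq F.a_assoc F.l_neg)
  then have "x \<in> N +>\<^bsub>F\<^esub> y" using assms(3) unfolding a_r_coset_def' by blast
  then show ?thesis using F.a_repr_independence[OF _ assms(2)] N.subgroup_axioms by metis
qed

locale tensor_product = V: module K V + W: module K W
  for K :: "'k ring" and V :: "('k, 'a) module" and W :: "('k, 'b) module"
begin

abbreviation "free_pairs \<equiv> free_module K (carrier V \<times> carrier W)"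
abbreviation "rel \<equiv> tensor_rel K V W"

lemma module_free_pairs: "module K free_pairs"
  by (rule module_free_module) (rule V.R.is_cring)

lemma free_basis_pair:
  "v \<in> carrier V \<Longrightarrow> w \<in> carrier W \<Longrightarrow> free_basis K (v, w) \<in> carrier free_pairs"
  by (rule free_basis_closed) (auto simp: V.R.is_cring)

lemma bilinearity_relators_closed: "bilinearity_relators K V W \<subseteq> carrier free_pairs"
proof -
  interpret F: module K free_pairs by (rule module_free_pairs)
  show ?thesis
    unfolding bilinearity_relators_def Let_def
    by (auto simp: free_basis_pair intro!: F.minus_closed F.a_closed F.smult_closed)
qed

sublocale quotient_by_submodule K free_pairs rel
  unfolding quotient_by_submodule_def tensor_rel_def
  using module_free_pairs submodule_submodule_span[OF module_free_pairs bilinearity_relators_closed] by blast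

lemma module_tensor: "module K (tensor K V W)"
  unfolding tensor_def by (rule module_quotient)

lemma relators_in_rel: "bilinearity_relators K V W \<subseteq> rel"
  unfolding tensor_rel_def by (rule submodule_span_superset[OF module_free_pairs bilinearity_relators_closed])

lemma tensor_ops:
  "x \<in> carrier free_pairs \<Longrightarrow> y \<in> carrier free_pairs \<Longrightarrow>
    (rel +>\<^bsub>free_pairs\<^esub> x) \<oplus>\<^bsub>tensor K V W\<^esub> (rel +>\<^bsub>free_pairs\<^esub> y) = rel +>\<^bsub>free_pairs\<^esub> (x \<oplus>\<^bsub>free_pairs\<^esub> y)"
  "a \<in> carrier K \<Longrightarrow> x \<in> carrier free_pairs \<Longrightarrow>
    a \<odot>\<^bsub>tensor K V W\<^esub> (rel +>\<^bsub>free_pairs\<^esub> x) = rel +>\<^bsub>free_pairs\<^esub> (a \<odot>\<^bsub>free_pairs\<^esub> x)"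
  "\<zero>\<^bsub>tensor K V W\<^esub> = rel +>\<^bsub>free_pairs\<^esub> \<zero>\<^bsub>free_pairs\<^esub>"
  unfolding tensor_def by (simp_all add: quotient_simps)

lemma tensor_carrier: "t \<in> carrier (tensor K V W) \<longleftrightarrow> (\<exists>c\<in>carrier free_pairs. t = rel +>\<^bsub>free_pairs\<^esub> c)"
  unfolding tensor_def by (rule quotient_carrier)

text \<open>Each law says that two cosets agree because the difference of their representatives is a
  generating relator. The chains of \<open>UnI1\<close> and \<open>UnI2\<close> pick the right one
  of the four families.\<close>

lemma bilinear_pure: "bilinear_map K V W (tensor K V W) (pure K V W)"
proof -
  note B = free_basis_pair
  have rI: "x \<in> bilinearity_relators K V W \<Longrightarrow> x \<in> rel" for x using relators_in_rel by blast
  show ?thesis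
  proof (intro bilinear_mapI linear_mapI)
    fix v v' w assume vw: "v \<in> carrier V" "v' \<in> carrier V" "w \<in> carrier W"
    show "pure K V W (v \<oplus>\<^bsub>V\<^esub> v') w = pure K V W v w \<oplus>\<^bsub>tensor K V W\<^esub> pure K V W v' w"
      unfolding pure_def tensor_ops(1)[OF B[OF vw(1,3)] B[OF vw(2,3)]]
      by (rule coset_eqI, use vw B in simp, use vw B in simp, rule rI,
          unfold bilinearity_relators_def Let_def, rule UnI1, rule UnI1, rule UnI1) (use vw in blast)
  next
    fix v w w' assume vw: "v \<in> carrier V" "w \<in> carrier W" "w' \<in> carrier W"
    show "pure K V W v (w \<oplus>\<^bsub>W\<^esub> w') = pure K V W v w \<oplus>\<^bsub>tensor K V W\<^esub> pure K V W v w'"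
      unfolding pure_def tensor_ops(1)[OF B[OF vw(1,2)] B[OF vw(1,3)]]
      by (rule coset_eqI, use vw B in simp, use vw B in simp, rule rI,
          unfold bilinearity_relators_def Let_def, rule UnI1, rule UnI1, rule UnI2) (use vw in blast)
  next
    fix a v w assume vw: "a \<in> carrier K" "v \<in> carrier V" "w \<in> carrier W"
    show "pure K V W (a \<odot>\<^bsub>V\<^esub> v) w = a \<odot>\<^bsub>tensor K V W\<^esub> pure K V W v w"
      unfolding pure_def tensor_ops(2)[OF vw(1) B[OF vw(2,3)]]
      by (rule coset_eqI, use vw B in simp, use vw B in simp, rule rI,
          unfold bilinearity_relators_def Let_def, rule UnI1, rule UnI2) (use vw in blast)
    show "pure K V W v (a \<odot>\<^bsub>W\<^esub> w) = a \<odot>\<^bsub>tensor K V W\<^esub> pure K V W v w"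
      unfolding pure_def tensor_ops(2)[OF vw(1) B[OF vw(2,3)]]
      by (rule coset_eqI, use vw B in simp, use vw B in simp, rule rI,
          unfold bilinearity_relators_def Let_def, rule UnI2) (use vw in blast)
  qed (auto simp: pure_def tensor_carrier B)
qed

lemma bilinear_Pi: "bilinear_map K V W Z B \<Longrightarrow> (\<lambda>(v, w). B v w) \<in> carrier V \<times> carrier W \<rightarrow> carrier Z"
  by (auto intro: bilinear_map_closed)

text \<open>The kernel of the linear extension of \<open>B\<close> is a submodule, and bilinearity
  of \<open>B\<close> puts every relator into it; hence it contains their span.\<close>

lemma free_eval_rel:
  assumes "module K Z" "bilinear_map K V W Z B" "c \<in> rel"
  shows "free_eval K Z (\<lambda>(v, w). B v w) c = \<zero>\<^bsub>Z\<^esub>"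
proof -
  interpret Z: module K Z by fact
  let ?f = "free_eval K Z (\<lambda>(v, w). B v w)"
  have f: "linear_map K free_pairs Z ?f" by (rule linear_map_free_eval[OF assms(1) bilinear_Pi[OF assms(2)]])
  note fl = linear_map_minus[OF module_free_pairs assms(1) f] linear_map_add[OF f] linear_map_smult[OF f]
  have fb: "?f (free_basis K (v, w)) = B v w" if "v \<in> carrier V" "w \<in> carrier W" for v w
    using free_eval_basis[OF assms(1) bilinear_Pi[OF assms(2)], of "(v, w)"] that by simp
  have L: "w \<in> carrier W \<Longrightarrow> linear_map K V Z (\<lambda>v. B v w)" "v \<in> carrier V \<Longrightarrow> linear_map K W Z (B v)" for v w
    using assms(2) by (auto simp: bilinear_map_def)
  have "bilinearity_relators K V W \<subseteq> {x \<in> carrier free_pairs. ?f x = \<zero>\<^bsub>Z\<^esub>}"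
  proof
    fix x assume x: "x \<in> bilinearity_relators K V W"
    then have "?f x = \<zero>\<^bsub>Z\<^esub>"
      unfolding bilinearity_relators_def Let_def
      by (auto simp: fl fb free_basis_pair linear_map_add[OF L(1)] linear_map_add[OF L(2)]
        linear_map_smult[OF L(1)] linear_map_smult[OF L(2)] bilinear_map_closed[OF assms(2)] Z.minus_eq Z.r_neg)
    then show "x \<in> {x \<in> carrier free_pairs. ?f x = \<zero>\<^bsub>Z\<^esub>}"
      using x bilinearity_relators_closed by blast
  qed
  then have "rel \<subseteq> {x \<in> carrier free_pairs. ?f x = \<zero>\<^bsub>Z\<^esub>}"
    unfolding tensor_rel_def
    by (rule submodule_span_least[OF module_free_pairs bilinearity_relators_closed
        submodule_kernel[OF module_free_pairs assms(1) f]])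
  then show ?thesis using assms(3) by blast
qed

text \<open>Independence of the choice in \<open>lift\<close>: the chosen representative differs
  from \<open>c\<close> by an element of \<open>rel\<close>, on which the linear extension
  vanishes.\<close>

lemma lift_coset:
  assumes "module K Z" "bilinear_map K V W Z B" "c \<in> carrier free_pairs"
  shows "lift K Z (rel +>\<^bsub>free_pairs\<^esub> c) B = free_eval K Z (\<lambda>(v, w). B v w) c"
proof -
  interpret Z: module K Z by fact
  let ?f = "free_eval K Z (\<lambda>(v, w). B v w)"
  have f: "linear_map K free_pairs Z ?f" by (rule linear_map_free_eval[OF assms(1) bilinear_Pi[OF assms(2)]])
  have "c \<in> rel +>\<^bsub>free_pairs\<^esub> c" by (rule a_rcos_self[OF assms(3)])
  then have "(SOME d. d \<in> rel +>\<^bsub>free_pairs\<^esub> c) \<in> rel +>\<^bsub>free_pairs\<^esub> c"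
    by (rule someI[where P = "\<lambda>d. d \<in> _"])
  then obtain n where n: "n \<in> rel" "(SOME d. d \<in> rel +>\<^bsub>free_pairs\<^esub> c) = n \<oplus>\<^bsub>free_pairs\<^esub> c"
    by (auto simp: a_r_coset_def')
  have "lift K Z (rel +>\<^bsub>free_pairs\<^esub> c) B = ?f (n \<oplus>\<^bsub>free_pairs\<^esub> c)"
    by (simp add: lift_def Let_def free_eval_def n(2) case_prod_beta)
  also have "\<dots> = ?f n \<oplus>\<^bsub>Z\<^esub> ?f c"
    by (rule linear_map_add[OF f _ assms(3)]) (use n(1) a_subset in blast)
  also have "\<dots> = ?f c"
    using free_eval_rel[OF assms(1,2) n(1)] linear_map_closed[OF f assms(3)] by simp
  finally show ?thesis .
qed

lemma lift_pure:
  assumes "module K Z" "bilinear_map K V W Z B" "v \<in> carrier V" "w \<in> carrier W"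
  shows "lift K Z (pure K V W v w) B = B v w"
  unfolding pure_def lift_coset[OF assms(1,2) free_basis_pair[OF assms(3,4)]]
  using free_eval_basis[OF assms(1) bilinear_Pi[OF assms(2)], of "(v, w)"] assms by simp

lemma linear_lift:
  assumes "module K Z" "bilinear_map K V W Z B"
  shows "linear_map K (tensor K V W) Z (\<lambda>t. lift K Z t B)"
proof -
  have f: "linear_map K free_pairs Z (free_eval K Z (\<lambda>(v, w). B v w))"
    by (rule linear_map_free_eval[OF assms(1) bilinear_Pi[OF assms(2)]])
  show ?thesis
    by (rule linear_mapI) (auto simp: tensor_carrier tensor_ops lift_coset[OF assms]
        linear_map_add[OF f] linear_map_smult[OF f] linear_map_closed[OF f])
qed

lemma tensor_induct [consumes 1, case_names zero add smult pure]:
  assumes t: "t \<in> carrier (tensor K V W)"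
    and zero: "P \<zero>\<^bsub>tensor K V W\<^esub>"
    and add: "\<And>s t. s \<in> carrier (tensor K V W) \<Longrightarrow> t \<in> carrier (tensor K V W) \<Longrightarrow> P s \<Longrightarrow> P t
      \<Longrightarrow> P (s \<oplus>\<^bsub>tensor K V W\<^esub> t)"
    and smult: "\<And>a t. a \<in> carrier K \<Longrightarrow> t \<in> carrier (tensor K V W) \<Longrightarrow> P t \<Longrightarrow> P (a \<odot>\<^bsub>tensor K V W\<^esub> t)"
    and pure: "\<And>v w. v \<in> carrier V \<Longrightarrow> w \<in> carrier W \<Longrightarrow> P (pure K V W v w)"
  shows "P t"
proof -
  obtain c where c: "c \<in> carrier free_pairs" and tc: "t = rel +>\<^bsub>free_pairs\<^esub> c" using t by (auto simp: tensor_carrier)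
  have "P (rel +>\<^bsub>free_pairs\<^esub> c)"
    using V.R.is_cring c
  proof (induction rule: free_module_induct)
    case zero
    show ?case using assms(2) by (simp add: tensor_ops)
  next
    case (add c d)
    then show ?case using assms(3)[of "rel +>\<^bsub>free_pairs\<^esub> c" "rel +>\<^bsub>free_pairs\<^esub> d"]
      by (auto simp: tensor_ops tensor_carrier)
  next
    case (smult a c)
    then show ?case using assms(4)[of a "rel +>\<^bsub>free_pairs\<^esub> c"]
      by (auto simp: tensor_ops tensor_carrier)
  next
    case (basis x)
    then show ?case using assms(5)[of "fst x" "snd x"] by (auto simp: pure_def)
  qed
  then show ?thesis by (simp add: tc)
qed

text \<open>Pure tensors generate the tensor product, so later identities of linear maps on tensors
  are checked on pure tensors only.\<close>

lemma tensor_ext: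
  assumes "module K Z" "linear_map K (tensor K V W) Z f" "linear_map K (tensor K V W) Z g"
    and "\<And>v w. v \<in> carrier V \<Longrightarrow> w \<in> carrier W \<Longrightarrow> f (pure K V W v w) = g (pure K V W v w)"
    and "t \<in> carrier (tensor K V W)"
  shows "f t = g t"
  using assms(5)
proof (induction rule: tensor_induct)
  case zero
  show ?case by (simp add: linear_map_zero[OF module_tensor assms(1)] assms(2,3))
next
  case (add s t)
  then show ?case by (simp add: linear_map_add[OF assms(2)] linear_map_add[OF assms(3)])
next
  case (smult a t)
  then show ?case by (simp add: linear_map_smult[OF assms(2)] linear_map_smult[OF assms(3)])
qed (rule assms(4))

lemma lift_closed:
  "module K Z \<Longrightarrow> bilinear_map K V W Z B \<Longrightarrow> t \<in> carrier (tensor K V W) \<Longrightarrow> lift K Z t B \<in> carrier Z"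
  by (rule linear_map_closed[OF linear_lift])

lemma lift_unique:
  assumes "module K Z" "bilinear_map K V W Z B" "linear_map K (tensor K V W) Z f"
    and "\<And>v w. v \<in> carrier V \<Longrightarrow> w \<in> carrier W \<Longrightarrow> f (pure K V W v w) = B v w"
    and "t \<in> carrier (tensor K V W)"
  shows "f t = lift K Z t B"
  by (rule tensor_ext[OF assms(1,3) linear_lift[OF assms(1,2)] _ assms(5)])
    (simp add: assms(4) lift_pure[OF assms(1,2)])

lemma bilinear_map_cong:
  assumes "\<And>v w. v \<in> carrier V \<Longrightarrow> w \<in> carrier W \<Longrightarrow> B v w = B' v w"
  shows "bilinear_map K V W Z B \<longleftrightarrow> bilinear_map K V W Z B'"
  unfolding bilinear_map_def
  by (intro conj_cong ball_cong refl linear_map_cong[OF V.module_axioms] linear_map_cong[OF W.module_axioms] assms)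

text \<open>The rule for rewriting under a Sweedler sum. Only the right-hand integrand needs a
  bilinearity proof, since agreement on the carriers passes it to the left-hand one.\<close>

lemma lift_cong:
  assumes "t \<in> carrier (tensor K V W)" "module K Z" "bilinear_map K V W Z B'"
    and "\<And>v w. v \<in> carrier V \<Longrightarrow> w \<in> carrier W \<Longrightarrow> B v w = B' v w"
  shows "lift K Z t B = lift K Z t B'"
proof -
  have B: "bilinear_map K V W Z B"
    using assms(3) by (rule bilinear_map_cong[THEN iffD2, rotated]) (rule assms(4))
  show ?thesis
    by (rule lift_unique[OF assms(2,3) linear_lift[OF assms(2) B] _ assms(1)])
      (simp add: lift_pure[OF assms(2) B] assms(4))
qed

text \<open>Both sides are linear in \<open>t\<close> and agree on pure tensors. This is how
  actions, coactions and tensor factors are moved into or out of a Sweedler sum.\<close>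

lemma linear_map_of_lift:
  assumes "t \<in> carrier (tensor K V W)" "module K Z" "module K Z'" "linear_map K Z Z' f" "bilinear_map K V W Z B"
  shows "f (lift K Z t B) = lift K Z' t (\<lambda>v w. f (B v w))"
proof (rule lift_unique[OF assms(3) _ linear_map_comp[OF assms(4) linear_lift[OF assms(2,5)]] _ assms(1)])
  show "bilinear_map K V W Z' (\<lambda>v w. f (B v w))"
    by (intro bilinear_mapI linear_map_comp[OF assms(4)]) (use assms(5) in \<open>auto simp: bilinear_map_def\<close>)
qed (simp add: lift_pure[OF assms(2,5)])

text \<open>For fixed parameters the sum of two lifts is linear in the tensor and has the required
  values on pure tensors, so uniqueness identifies it with the lift at the added parameter; likewise
  for scalar multiples.\<close>

lemma linear_lift_param:
  assumes "t \<in> carrier (tensor K V W)" "module K U" "module K Z"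
    and lin: "\<And>v w. v \<in> carrier V \<Longrightarrow> w \<in> carrier W \<Longrightarrow> linear_map K U Z (\<lambda>u. B u v w)"
    and bil: "\<And>u. u \<in> carrier U \<Longrightarrow> bilinear_map K V W Z (B u)"
  shows "linear_map K U Z (\<lambda>u. lift K Z t (B u))"
proof -
  interpret U: module K U by fact
  interpret Z: module K Z by fact
  note LL = linear_lift[OF assms(3) bil]
  show ?thesis
  proof (rule linear_mapI)
    fix x y assume xy: "x \<in> carrier U" "y \<in> carrier U"
    show "lift K Z t (B (x \<oplus>\<^bsub>U\<^esub> y)) = lift K Z t (B x) \<oplus>\<^bsub>Z\<^esub> lift K Z t (B y)"
      by (rule lift_unique[symmetric, OF assms(3) bil linear_map_add_fun[OF assms(3) LL LL] _ assms(1)])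
        (use xy in \<open>auto simp: lift_pure[OF assms(3) bil] linear_map_add[OF lin]\<close>)
  next
    fix a x assume ax: "a \<in> carrier K" "x \<in> carrier U"
    show "lift K Z t (B (a \<odot>\<^bsub>U\<^esub> x)) = a \<odot>\<^bsub>Z\<^esub> lift K Z t (B x)"
      by (rule lift_unique[symmetric, OF assms(3) bil linear_map_smult_fun[OF assms(3) LL] _ assms(1)])
        (use ax in \<open>auto simp: lift_pure[OF assms(3) bil] linear_map_smult[OF lin]\<close>)
  qed (rule lift_closed[OF assms(3) bil assms(1)])
qed

end

section \<open>Sweedler calculus\<close>

definition trilinear_map ::
    "'k ring \<Rightarrow> ('k, 'a) module \<Rightarrow> ('k, 'b) module \<Rightarrow> ('k, 'c) module \<Rightarrow> ('k, 'z) module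
      \<Rightarrow> ('a \<Rightarrow> 'b \<Rightarrow> 'c \<Rightarrow> 'z) \<Rightarrow> bool" where
  "trilinear_map K A B C Z T \<longleftrightarrow>
     (\<forall>a\<in>carrier A. bilinear_map K B C Z (T a)) \<and>
     (\<forall>b\<in>carrier B. \<forall>c\<in>carrier C. linear_map K A Z (\<lambda>a. T a b c))"

lemma trilinear_mapI:
  assumes "\<And>a b. a \<in> carrier A \<Longrightarrow> b \<in> carrier B \<Longrightarrow> linear_map K C Z (\<lambda>c. T a b c)"
    and "\<And>a c. a \<in> carrier A \<Longrightarrow> c \<in> carrier C \<Longrightarrow> linear_map K B Z (\<lambda>b. T a b c)"
    and "\<And>b c. b \<in> carrier B \<Longrightarrow> c \<in> carrier C \<Longrightarrow> linear_map K A Z (\<lambda>a. T a b c)"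
  shows "trilinear_map K A B C Z T"
  using assms by (auto simp: trilinear_map_def bilinear_map_def)

lemma tensor_productI: "module K V \<Longrightarrow> module K W \<Longrightarrow> tensor_product K V W"
  by (simp add: tensor_product_def)

lemmas module_tensor = tensor_product.module_tensor[OF tensor_productI]
lemmas pure_bilinear = tensor_product.bilinear_pure[OF tensor_productI]
lemmas pure_closed = bilinear_map_closed[OF pure_bilinear]
lemmas linear_pure_left = bilinear_map_left[OF pure_bilinear]
lemmas linear_pure_right = bilinear_map_right[OF pure_bilinear]
lemmas lift_pure = tensor_product.lift_pure[OF tensor_productI]
lemmas linear_lift = tensor_product.linear_lift[OF tensor_productI]
lemmas tensor_ext = tensor_product.tensor_ext[OF tensor_productI]
lemmas lift_cong = tensor_product.lift_cong[OF tensor_productI]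
lemmas linear_map_of_lift = tensor_product.linear_map_of_lift[OF tensor_productI]

lemma lift_closed:
  "t \<in> carrier (tensor K V W) \<Longrightarrow> module K V \<Longrightarrow> module K W \<Longrightarrow> module K Z \<Longrightarrow> bilinear_map K V W Z B \<Longrightarrow>
    lift K Z t B \<in> carrier Z"
  by (rule linear_map_closed[OF linear_lift])

lemma linear_lift_arg:
  assumes "linear_map K U (tensor K V W) f" "module K V" "module K W" "module K Z" "bilinear_map K V W Z B"
  shows "linear_map K U Z (\<lambda>u. lift K Z (f u) B)"
  by (rule linear_map_comp[OF linear_lift[OF assms(2-5)] assms(1)])

text \<open>Bilinearity in the summation variables is split into linearity in one variable at a
  time, the form that the other introduction rules can resolve.\<close>

lemma linear_lift_fun:
  assumes "t \<in> carrier (tensor K V W)" "module K U" "module K V" "module K W" "module K Z"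
    and "\<And>v w. v \<in> carrier V \<Longrightarrow> w \<in> carrier W \<Longrightarrow> linear_map K U Z (\<lambda>u. B u v w)"
    and "\<And>u v. u \<in> carrier U \<Longrightarrow> v \<in> carrier V \<Longrightarrow> linear_map K W Z (\<lambda>w. B u v w)"
    and "\<And>u w. u \<in> carrier U \<Longrightarrow> w \<in> carrier W \<Longrightarrow> linear_map K V Z (\<lambda>v. B u v w)"
  shows "linear_map K U Z (\<lambda>u. lift K Z t (\<lambda>v w. B u v w))"
  by (rule tensor_product.linear_lift_param[OF tensor_productI[OF assms(3,4)] assms(1,2,5,6)])
    (auto intro: bilinear_mapI assms)

text \<open>Syntax-directed rules: repeated resolution takes a nested Sweedler expression apart and
  proves it linear in a chosen variable, together with the membership conditions that arise.\<close>

lemmas linear_intros =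
  linear_map_id linear_pure_left linear_pure_right linear_lift_arg linear_lift_fun bilinear_mapI trilinear_mapI
  module_tensor pure_closed lift_closed

lemma lift_of_lift:
  assumes "s \<in> carrier (tensor K A B)" "module K A" "module K B" "module K V" "module K W" "module K Z"
    "bilinear_map K A B (tensor K V W) C" "bilinear_map K V W Z D"
  shows "lift K Z (lift K (tensor K V W) s C) D = lift K Z s (\<lambda>a b. lift K Z (C a b) D)"
  by (rule linear_map_of_lift[OF assms(2,3,1) module_tensor[OF assms(4,5)] assms(6)
      linear_lift[OF assms(4-6,8)] assms(7)])

lemma lift_tensor_map:
  assumes "t \<in> carrier (tensor K A B)" "module K A" "module K B" "module K V" "module K W" "module K Z"
    "linear_map K A V f" "linear_map K B W g" "bilinear_map K V W Z D"
  shows "lift K Z (tensor_map K V W f g t) D = lift K Z t (\<lambda>a b. D (f a) (g b))"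
proof -
  note f = linear_map_closed[OF assms(7)] and g = linear_map_closed[OF assms(8)]
  have b: "bilinear_map K A B (tensor K V W) (\<lambda>v w. pure K V W (f v) (g w))"
    by (intro bilinear_mapI linear_pure_left linear_pure_right assms f g)
  have d: "bilinear_map K A B Z (\<lambda>a b. D (f a) (g b))"
    by (intro bilinear_mapI bilinear_map_left[OF assms(9)] bilinear_map_right[OF assms(9)] assms f g)
  show ?thesis
    unfolding tensor_map_def lift_of_lift[OF assms(1-6) b assms(9)]
    by (rule lift_cong[OF assms(2,3,1,6) d]) (rule lift_pure[OF assms(4-6,9) f g])
qed

section \<open>Coassociativity in Sweedler form\<close>

locale linear_coaction =
  fixes K :: "'k ring" and C :: "('k, 'c) module" and \<Delta> :: "'c \<Rightarrow> ('k, 'c, 'c) tens"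
    and M :: "('k, 'm) module" and \<rho> :: "'m \<Rightarrow> ('k, 'c, 'm) tens"
  assumes modC: "module K C" and modM: "module K M"
    and lin\<Delta>: "linear_map K C (tensor K C C) \<Delta>" and lin\<rho>: "linear_map K M (tensor K C M) \<rho>"
begin

lemmas mods = modC modM module_tensor[OF modC modC] module_tensor[OF modC modM]
  module_tensor[OF modC module_tensor[OF modC modM]]
lemmas lins = lin\<Delta> lin\<rho> linear_map_comp[OF lin\<Delta>] linear_map_comp[OF lin\<rho>]
  linear_map_closed[OF lin\<Delta>] linear_map_closed[OF lin\<rho>]

lemma tensor_assoc_comult:
  assumes "t \<in> carrier (tensor K C M)"
  shows "tensor_assoc K C C M (tensor_map K (tensor K C C) M \<Delta> (\<lambda>x. x) t)
    = lift K (tensor K C (tensor K C M)) t (\<lambda>h x. lift K (tensor K C (tensor K C M)) (\<Delta> h)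
        (\<lambda>a b. pure K C (tensor K C M) a (pure K C M b x)))"
  unfolding tensor_assoc_def
  by (rule lift_tensor_map[OF assms]) (rule assms linear_intros mods lins | assumption)+

text \<open>The trilinear \<open>T\<close> induces a linear map \<open>?L\<close> on the tensor
  product of \<open>C\<close> with (\<open>C\<close> tensor \<open>M\<close>). Applying it to both
  sides of the coassociativity axiom and evaluating the nested lifts gives the two sums. In this
  form coassociativity regroups a sum without displaying any associator.\<close>

lemma comodule_lift_coassoc:
  assumes com: "comodule K C \<Delta> \<epsilon> M \<rho>" and Z: "module K Z" and T: "trilinear_map K C C M Z T" and m: "m \<in> carrier M"
  shows "lift K Z (\<rho> m) (\<lambda>h x. lift K Z (\<Delta> h) (\<lambda>a b. T a b x)) = lift K Z (\<rho> m) (\<lambda>a y. lift K Z (\<rho> y) (\<lambda>b x. T a b x))"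
proof -
  let ?CCM = "tensor K C (tensor K C M)"
  let ?L = "\<lambda>s. lift K Z s (\<lambda>a u. lift K Z u (\<lambda>b x. T a b x))"
  have T1: "bilinear_map K C M Z (T a)" if "a \<in> carrier C" for a
    using T that by (simp add: trilinear_map_def)
  have T2: "linear_map K C Z (\<lambda>a. T a b x)" if "b \<in> carrier C" "x \<in> carrier M" for b x
    using T that by (simp add: trilinear_map_def)
  have T3: "linear_map K C Z (\<lambda>b. T a b x)" if "a \<in> carrier C" "x \<in> carrier M" for a x
    using T1[OF that(1)] that(2) by (simp add: bilinear_map_def)
  have T4: "linear_map K M Z (\<lambda>x. T a b x)" if "a \<in> carrier C" "b \<in> carrier C" for a b
    using T1[OF that(1)] that(2) by (simp add: bilinear_map_def)
  note Ts = T1 T2 T3 T4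
  have r: "\<rho> m \<in> carrier (tensor K C M)" using m by (rule lins)
  have L: "bilinear_map K C (tensor K C M) Z (\<lambda>a u. lift K Z u (\<lambda>b x. T a b x))"
    by (rule assms Ts linear_intros mods lins | assumption)+
  have "?L (tensor_assoc K C C M (tensor_map K (tensor K C C) M \<Delta> (\<lambda>x. x) (\<rho> m)))
      = lift K Z (\<rho> m) (\<lambda>h x. ?L (lift K ?CCM (\<Delta> h) (\<lambda>a b. pure K C (tensor K C M) a (pure K C M b x))))"
    unfolding tensor_assoc_comult[OF r]
    by (rule lift_of_lift[OF r]) (rule assms Ts linear_intros mods lins L | assumption)+
  also have "\<dots> = lift K Z (\<rho> m) (\<lambda>h x. lift K Z (\<Delta> h) (\<lambda>a b. T a b x))"
  proof (rule lift_cong[OF modC modM r Z])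
    fix h x assume hx: "h \<in> carrier C" "x \<in> carrier M"
    have dh: "\<Delta> h \<in> carrier (tensor K C C)" using hx(1) by (rule lins)
    have "?L (lift K ?CCM (\<Delta> h) (\<lambda>a b. pure K C (tensor K C M) a (pure K C M b x)))
        = lift K Z (\<Delta> h) (\<lambda>a b. ?L (pure K C (tensor K C M) a (pure K C M b x)))"
      by (rule lift_of_lift[OF dh]) (rule hx assms Ts linear_intros mods lins L | assumption)+
    also have "\<dots> = lift K Z (\<Delta> h) (\<lambda>a b. T a b x)"
    proof (rule lift_cong[OF modC modC dh Z])
      fix a b assume ab: "a \<in> carrier C" "b \<in> carrier C"
      have "?L (pure K C (tensor K C M) a (pure K C M b x)) = lift K Z (pure K C M b x) (T a)"
        by (rule lift_pure[OF modC _ Z L]) (rule ab hx pure_closed mods)+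
      also have "\<dots> = T a b x"
        by (rule lift_pure[OF modC modM Z T1[OF ab(1)] ab(2) hx(2)])
      finally show "?L (pure K C (tensor K C M) a (pure K C M b x)) = T a b x" .
    qed (rule hx Ts bilinear_mapI | assumption)+
    finally show "?L (lift K ?CCM (\<Delta> h) (\<lambda>a b. pure K C (tensor K C M) a (pure K C M b x)))
      = lift K Z (\<Delta> h) (\<lambda>a b. T a b x)" .
  qed (rule assms Ts linear_intros mods lins | assumption)+
  finally have 1: "?L (tensor_assoc K C C M (tensor_map K (tensor K C C) M \<Delta> (\<lambda>x. x) (\<rho> m))) = \<dots>" .
  have "?L (tensor_map K C (tensor K C M) (\<lambda>x. x) \<rho> (\<rho> m)) = lift K Z (\<rho> m) (\<lambda>a y. lift K Z (\<rho> y) (\<lambda>b x. T a b x))"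
    by (rule lift_tensor_map[OF r]) (rule assms Ts linear_intros mods lins L | assumption)+
  moreover have "tensor_assoc K C C M (tensor_map K (tensor K C C) M \<Delta> (\<lambda>x. x) (\<rho> m))
      = tensor_map K C (tensor K C M) (\<lambda>x. x) \<rho> (\<rho> m)"
    using com m by (simp add: comodule_def)
  ultimately show ?thesis using 1 by simp
qed

end

text \<open>A coalgebra coacts on itself, so the regrouping rule for comodules also covers
  comultiplications.\<close>

lemma coalgebra_comodule: "coalgebra K C \<Delta> \<epsilon> \<Longrightarrow> comodule K C \<Delta> \<epsilon> C \<Delta>"
  by (simp add: coalgebra_def comodule_def)

section \<open>Quasigroups\<close>

locale quasigroup_inverses =
  fixes Q :: "'q monoid"
  assumes quasigroup: "quasigroup Q"
begin

lemma mult_closed [simp, intro]: "p \<in> carrier Q \<Longrightarrow> q \<in> carrier Q \<Longrightarrow> p \<otimes>\<^bsub>Q\<^esub> q \<in> carrier Q"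
  and one_closed [simp, intro]: "\<one>\<^bsub>Q\<^esub> \<in> carrier Q"
  and one_mult [simp]: "p \<in> carrier Q \<Longrightarrow> \<one>\<^bsub>Q\<^esub> \<otimes>\<^bsub>Q\<^esub> p = p"
  and mult_one [simp]: "p \<in> carrier Q \<Longrightarrow> p \<otimes>\<^bsub>Q\<^esub> \<one>\<^bsub>Q\<^esub> = p"
  using quasigroup by (auto simp: quasigroup_def)

lemma is_qinv_qinv:
  assumes p: "p \<in> carrier Q" shows "is_qinv Q p (qinv Q p)"
proof -
  obtain r where r: "is_qinv Q p r" using quasigroup p by (auto simp: quasigroup_def)
  have "s = r" if s: "is_qinv Q p s" for s
  proof -
    \<comment> \<open>Take the identity for \<open>q\<close> in the right cancellation law.
      Evaluating s(pr) by left cancellation and by pr = 1 then gives r = s with no use of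
      associativity.\<close>
    have "p \<otimes>\<^bsub>Q\<^esub> r = \<one>\<^bsub>Q\<^esub>" using r p one_closed unfolding is_qinv_def by (metis one_mult)
    moreover have "s \<otimes>\<^bsub>Q\<^esub> (p \<otimes>\<^bsub>Q\<^esub> r) = r" using s r by (simp add: is_qinv_def)
    ultimately show ?thesis using s by (simp add: is_qinv_def)
  qed
  then show ?thesis unfolding qinv_def using r by (rule_tac theI) auto
qed

lemma qinv_closed [simp, intro]: "p \<in> carrier Q \<Longrightarrow> qinv Q p \<in> carrier Q"
  and qinv_mult_mult [simp]: "p \<in> carrier Q \<Longrightarrow> q \<in> carrier Q \<Longrightarrow> qinv Q p \<otimes>\<^bsub>Q\<^esub> (p \<otimes>\<^bsub>Q\<^esub> q) = q"
  and mult_mult_qinv [simp]: "p \<in> carrier Q \<Longrightarrow> q \<in> carrier Q \<Longrightarrow> (q \<otimes>\<^bsub>Q\<^esub> p) \<otimes>\<^bsub>Q\<^esub> qinv Q p = q"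
  using is_qinv_qinv by (auto simp: is_qinv_def)

lemma qinv_mult [simp]: "p \<in> carrier Q \<Longrightarrow> qinv Q p \<otimes>\<^bsub>Q\<^esub> p = \<one>\<^bsub>Q\<^esub>"
  using qinv_mult_mult[of p "\<one>\<^bsub>Q\<^esub>"] by simp

lemma mult_qinv [simp]: "p \<in> carrier Q \<Longrightarrow> p \<otimes>\<^bsub>Q\<^esub> qinv Q p = \<one>\<^bsub>Q\<^esub>"
  using mult_mult_qinv[of p "\<one>\<^bsub>Q\<^esub>"] by simp

text \<open>Right cancellation for the inverse of p gives (p p') p'' = p, with primes for inverses,
  and p p' is the identity.\<close>

lemma qinv_qinv [simp]: "p \<in> carrier Q \<Longrightarrow> qinv Q (qinv Q p) = p"
  using mult_mult_qinv[of "qinv Q p" p] by simp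

lemma mult_qinv_mult [simp]: "p \<in> carrier Q \<Longrightarrow> q \<in> carrier Q \<Longrightarrow> p \<otimes>\<^bsub>Q\<^esub> (qinv Q p \<otimes>\<^bsub>Q\<^esub> q) = q"
  using qinv_mult_mult[of "qinv Q p" q] by simp

end

section \<open>Graded Hopf quasigroups\<close>

locale graded_hopf = quasigroup_inverses Q for Q :: "'q monoid" +
  fixes K :: "'k ring" and H :: "('q, 'k, 'h) hopf_data"
  assumes cring: "cring K" and hopf: "graded_hopf_quasigroup K Q H"
begin

abbreviation "HH p \<equiv> tensor K (hsp H p) (hsp H p)"

lemma module_hsp: "p \<in> carrier Q \<Longrightarrow> module K (hsp H p)"
  and coalgebra_hsp: "p \<in> carrier Q \<Longrightarrow> coalgebra K (hsp H p) (hcomul H p) (hcounit H p)"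
  and coalgebra_map_hmul: "p \<in> carrier Q \<Longrightarrow> q \<in> carrier Q \<Longrightarrow> coalgebra_map K
          (tensor K (hsp H p) (hsp H q))
          (tensor_comult K (hsp H p) (hcomul H p) (hsp H q) (hcomul H q))
          (tensor_counit K (hcounit H p) (hcounit H q))
          (hsp H (p \<otimes>\<^bsub>Q\<^esub> q)) (hcomul H (p \<otimes>\<^bsub>Q\<^esub> q)) (hcounit H (p \<otimes>\<^bsub>Q\<^esub> q))
          (hmul H p q)"
  and coalgebra_map_hunit: "coalgebra_map K (scalars K) (scalars_comult K) (\<lambda>a. a)
       (hsp H \<one>\<^bsub>Q\<^esub>) (hcomul H \<one>\<^bsub>Q\<^esub>) (hcounit H \<one>\<^bsub>Q\<^esub>) (hunit H)"
  and hprod_hone: "p \<in> carrier Q \<Longrightarrow> h \<in> carrier (hsp H p) \<Longrightarrow> hprod K H p \<one>\<^bsub>Q\<^esub> h (hone K H) = h"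
  and hone_hprod: "p \<in> carrier Q \<Longrightarrow> h \<in> carrier (hsp H p) \<Longrightarrow> hprod K H \<one>\<^bsub>Q\<^esub> p (hone K H) h = h"
  and linear_hanti: "p \<in> carrier Q \<Longrightarrow> linear_map K (hsp H p) (hsp H (qinv Q p)) (hanti H p)"
  and hanti_left: "p \<in> carrier Q \<Longrightarrow> q \<in> carrier Q \<Longrightarrow> h \<in> carrier (hsp H p) \<Longrightarrow> g \<in> carrier (hsp H q) \<Longrightarrow>
        lift K (hsp H q) (hcomul H p h) (\<lambda>h1 h2.
            hprod K H (qinv Q p) (p \<otimes>\<^bsub>Q\<^esub> q) (hanti H p h1) (hprod K H p q h2 g))
          = hcounit H p h \<odot>\<^bsub>hsp H q\<^esub> g"
  and hanti_right: "p \<in> carrier Q \<Longrightarrow> q \<in> carrier Q \<Longrightarrow> h \<in> carrier (hsp H p) \<Longrightarrow> g \<in> carrier (hsp H q) \<Longrightarrow>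
        lift K (hsp H q) (hcomul H p h) (\<lambda>h1 h2.
            hprod K H p (qinv Q p \<otimes>\<^bsub>Q\<^esub> q) h1 (hprod K H (qinv Q p) q (hanti H p h2) g))
          = hcounit H p h \<odot>\<^bsub>hsp H q\<^esub> g"
  using hopf unfolding graded_hopf_quasigroup_def by blast+

lemma linear_hcomul: "p \<in> carrier Q \<Longrightarrow> linear_map K (hsp H p) (HH p) (hcomul H p)"
  and linear_hcounit: "p \<in> carrier Q \<Longrightarrow> linear_map K (hsp H p) (scalars K) (hcounit H p)"
  and hcounit_left: "p \<in> carrier Q \<Longrightarrow> h \<in> carrier (hsp H p) \<Longrightarrow>
     lift K (hsp H p) (hcomul H p h) (\<lambda>x y. hcounit H p x \<odot>\<^bsub>hsp H p\<^esub> y) = h"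
  and hcounit_right: "p \<in> carrier Q \<Longrightarrow> h \<in> carrier (hsp H p) \<Longrightarrow>
     lift K (hsp H p) (hcomul H p h) (\<lambda>x y. hcounit H p y \<odot>\<^bsub>hsp H p\<^esub> x) = h"
  using coalgebra_hsp unfolding coalgebra_def by blast+

lemma linear_hmul: "p \<in> carrier Q \<Longrightarrow> q \<in> carrier Q \<Longrightarrow>
    linear_map K (tensor K (hsp H p) (hsp H q)) (hsp H (p \<otimes>\<^bsub>Q\<^esub> q)) (hmul H p q)"
  using coalgebra_map_hmul unfolding coalgebra_map_def by blast

lemma bilinear_hprod: "p \<in> carrier Q \<Longrightarrow> q \<in> carrier Q \<Longrightarrow>
    bilinear_map K (hsp H p) (hsp H q) (hsp H (p \<otimes>\<^bsub>Q\<^esub> q)) (hprod K H p q)"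
  unfolding hprod_def
  by (intro bilinear_mapI linear_map_comp[OF linear_hmul] linear_pure_left linear_pure_right linear_map_id
      module_hsp | assumption)+

text \<open>The target degree is a free \<open>r\<close> with an equation as premise, so the rule
  also resolves against goals whose degree is already simplified; the equation is closed afterwards
  by \<open>refl\<close>, a reversed quasigroup law or the simplifier. The later rules with such a
  premise follow this pattern.\<close>

lemma linear_hprod_left: "linear_map K U (hsp H p) f \<Longrightarrow> r = p \<otimes>\<^bsub>Q\<^esub> q \<Longrightarrow> p \<in> carrier Q \<Longrightarrow> q \<in> carrier Q \<Longrightarrow>
    g \<in> carrier (hsp H q) \<Longrightarrow> linear_map K U (hsp H r) (\<lambda>u. hprod K H p q (f u) g)"
  using bilinear_map_left[OF bilinear_hprod] by blast

lemma linear_hprod_right: "linear_map K U (hsp H q) f \<Longrightarrow> r = p \<otimes>\<^bsub>Q\<^esub> q \<Longrightarrow> p \<in> carrier Q \<Longrightarrow> q \<in> carrier Q \<Longrightarrow>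
    h \<in> carrier (hsp H p) \<Longrightarrow> linear_map K U (hsp H r) (\<lambda>u. hprod K H p q h (f u))"
  using bilinear_map_right[OF bilinear_hprod] by blast

lemma hprod_closed: "r = p \<otimes>\<^bsub>Q\<^esub> q \<Longrightarrow> p \<in> carrier Q \<Longrightarrow> q \<in> carrier Q \<Longrightarrow>
    h \<in> carrier (hsp H p) \<Longrightarrow> g \<in> carrier (hsp H q) \<Longrightarrow> hprod K H p q h g \<in> carrier (hsp H r)"
  using bilinear_map_closed[OF bilinear_hprod] by blast

lemma linear_hanti_comp: "linear_map K U (hsp H p) f \<Longrightarrow> r = qinv Q p \<Longrightarrow> p \<in> carrier Q \<Longrightarrow>
    linear_map K U (hsp H r) (\<lambda>u. hanti H p (f u))"
  using linear_map_comp[OF linear_hanti] by blast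

lemma hanti_closed: "r = qinv Q p \<Longrightarrow> p \<in> carrier Q \<Longrightarrow> h \<in> carrier (hsp H p) \<Longrightarrow> hanti H p h \<in> carrier (hsp H r)"
  using linear_map_closed[OF linear_hanti] by blast

lemma linear_hcomul_comp: "linear_map K U (hsp H p) f \<Longrightarrow> p \<in> carrier Q \<Longrightarrow>
    linear_map K U (HH p) (\<lambda>u. hcomul H p (f u))"
  by (rule linear_map_comp[OF linear_hcomul])

lemma hcomul_closed: "p \<in> carrier Q \<Longrightarrow> h \<in> carrier (hsp H p) \<Longrightarrow> hcomul H p h \<in> carrier (HH p)"
  by (rule linear_map_closed[OF linear_hcomul])

lemma hcounit_closed: "p \<in> carrier Q \<Longrightarrow> h \<in> carrier (hsp H p) \<Longrightarrow> hcounit H p h \<in> carrier K"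
  using linear_map_closed[OF linear_hcounit] by (simp add: scalars_def)

lemma linear_hcounit_smult: "linear_map K U (hsp H p) f \<Longrightarrow> p \<in> carrier Q \<Longrightarrow> module K W \<Longrightarrow> w \<in> carrier W \<Longrightarrow>
    linear_map K U W (\<lambda>u. hcounit H p (f u) \<odot>\<^bsub>W\<^esub> w)"
  by (rule linear_map_scalars[OF _ linear_map_comp[OF linear_hcounit]])

lemma linear_hcounit_smult_right: "linear_map K U W f \<Longrightarrow> p \<in> carrier Q \<Longrightarrow> module K W \<Longrightarrow> h \<in> carrier (hsp H p) \<Longrightarrow>
    linear_map K U W (\<lambda>u. hcounit H p h \<odot>\<^bsub>W\<^esub> f u)"
  by (rule linear_map_smult_fun[OF _ _ hcounit_closed])

lemma smult_closed: "module K W \<Longrightarrow> a \<in> carrier K \<Longrightarrow> w \<in> carrier W \<Longrightarrow> a \<odot>\<^bsub>W\<^esub> w \<in> carrier W"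
  by (rule module.smult_closed)

lemma one_scalars: "\<one>\<^bsub>K\<^esub> \<in> carrier (scalars K)"
proof -
  interpret cring K by (rule cring)
  show ?thesis by (simp add: scalars_def)
qed

lemma linear_hunit: "linear_map K (scalars K) (hsp H \<one>\<^bsub>Q\<^esub>) (hunit H)"
  using coalgebra_map_hunit unfolding coalgebra_map_def by blast

lemma hone_closed: "hone K H \<in> carrier (hsp H \<one>\<^bsub>Q\<^esub>)"
  unfolding hone_def by (rule linear_map_closed[OF linear_hunit one_scalars])

lemmas hopf_intros = module_hsp linear_hprod_left linear_hprod_right hprod_closed linear_hanti_comp hanti_closed
  linear_hcomul_comp hcomul_closed linear_hcounit_smult linear_hcounit_smult_right hcounit_closed smult_closed
  hone_closed linear_intros

text \<open>This unpacks the coalgebra map axiom for the multiplication: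
  \<open>tensor_comult\<close> interchanges the two middle factors, and \<open>hmul\<close> is
  pushed through both nested sums.\<close>

lemma hcomul_hprod:
  assumes pq: "p \<in> carrier Q" "q \<in> carrier Q" and h: "h \<in> carrier (hsp H p)" and g: "g \<in> carrier (hsp H q)"
  shows "hcomul H (p \<otimes>\<^bsub>Q\<^esub> q) (hprod K H p q h g) =
    lift K (HH (p \<otimes>\<^bsub>Q\<^esub> q)) (hcomul H p h) (\<lambda>h1 h2. lift K (HH (p \<otimes>\<^bsub>Q\<^esub> q)) (hcomul H q g) (\<lambda>g1 g2.
      pure K (hsp H (p \<otimes>\<^bsub>Q\<^esub> q)) (hsp H (p \<otimes>\<^bsub>Q\<^esub> q)) (hprod K H p q h1 g1) (hprod K H p q h2 g2)))"
proof -
  let ?P = "hsp H p" and ?Q = "hsp H q" and ?R = "hsp H (p \<otimes>\<^bsub>Q\<^esub> q)"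
  let ?T = "tensor K ?P ?Q"
  let ?TT = "tensor K ?T ?T"
  let ?m = "hmul H p q"
  note A = pq h g
  have pg: "pure K ?P ?Q h g \<in> carrier ?T" by (rule hopf_intros A)+
  have lm: "linear_map K U ?R (\<lambda>u. ?m (f u))" if "linear_map K U ?T f" for U and f :: "'u \<Rightarrow> _"
    by (rule linear_map_comp[OF linear_hmul that]) (rule A)+
  note mc = linear_map_closed[OF linear_hmul[OF pq]]
  have b: "bilinear_map K ?T ?T (HH (p \<otimes>\<^bsub>Q\<^esub> q)) (\<lambda>v w. pure K ?R ?R (?m v) (?m w))"
    by (rule hopf_intros mult_closed A lm mc | assumption)+
  have "hcomul H (p \<otimes>\<^bsub>Q\<^esub> q) (hprod K H p q h g) = tensor_map K ?R ?R ?m ?m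
      (tensor_comult K ?P (hcomul H p) ?Q (hcomul H q) (pure K ?P ?Q h g))"
    using coalgebra_map_hmul[OF pq] pg unfolding coalgebra_map_def hprod_def by blast
  also have "tensor_comult K ?P (hcomul H p) ?Q (hcomul H q) (pure K ?P ?Q h g) =
    lift K ?TT (hcomul H p h) (\<lambda>c1 c2. lift K ?TT (hcomul H q g) (\<lambda>d1 d2. pure K ?T ?T (pure K ?P ?Q c1 d1) (pure K ?P ?Q c2 d2)))"
    unfolding tensor_comult_def Let_def
    by (rule lift_pure) (rule A hopf_intros | assumption)+
  also have "tensor_map K ?R ?R ?m ?m \<dots> = lift K (HH (p \<otimes>\<^bsub>Q\<^esub> q)) (hcomul H p h) (\<lambda>c1 c2.
      tensor_map K ?R ?R ?m ?m (lift K ?TT (hcomul H q g) (\<lambda>d1 d2. pure K ?T ?T (pure K ?P ?Q c1 d1) (pure K ?P ?Q c2 d2))))"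
    unfolding tensor_map_def
    by (rule lift_of_lift) (rule A b hopf_intros mult_closed | assumption)+
  also have "\<dots> = lift K (HH (p \<otimes>\<^bsub>Q\<^esub> q)) (hcomul H p h) (\<lambda>h1 h2. lift K (HH (p \<otimes>\<^bsub>Q\<^esub> q)) (hcomul H q g) (\<lambda>g1 g2.
      pure K ?R ?R (hprod K H p q h1 g1) (hprod K H p q h2 g2)))"
  proof (rule lift_cong[where V = ?P and W = ?P])
    fix h1 h2 assume h12: "h1 \<in> carrier ?P" "h2 \<in> carrier ?P"
    have "tensor_map K ?R ?R ?m ?m (lift K ?TT (hcomul H q g) (\<lambda>d1 d2. pure K ?T ?T (pure K ?P ?Q h1 d1) (pure K ?P ?Q h2 d2)))
      = lift K (HH (p \<otimes>\<^bsub>Q\<^esub> q)) (hcomul H q g) (\<lambda>d1 d2.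
          tensor_map K ?R ?R ?m ?m (pure K ?T ?T (pure K ?P ?Q h1 d1) (pure K ?P ?Q h2 d2)))"
      unfolding tensor_map_def
      by (rule lift_of_lift) (rule A h12 b hopf_intros mult_closed | assumption)+
    also have "\<dots> = lift K (HH (p \<otimes>\<^bsub>Q\<^esub> q)) (hcomul H q g) (\<lambda>g1 g2.
      pure K ?R ?R (hprod K H p q h1 g1) (hprod K H p q h2 g2))"
    proof (rule lift_cong[where V = ?Q and W = ?Q])
      fix d1 d2 assume d: "d1 \<in> carrier ?Q" "d2 \<in> carrier ?Q"
      show "tensor_map K ?R ?R ?m ?m (pure K ?T ?T (pure K ?P ?Q h1 d1) (pure K ?P ?Q h2 d2))
        = pure K ?R ?R (hprod K H p q h1 d1) (hprod K H p q h2 d2)"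
        unfolding tensor_map_def hprod_def
        by (rule lift_pure) (rule A h12 d b hopf_intros mult_closed | assumption)+
    qed (rule A h12 hopf_intros mult_closed refl | assumption)+
    finally show "tensor_map K ?R ?R ?m ?m (lift K ?TT (hcomul H q g) (\<lambda>d1 d2. pure K ?T ?T (pure K ?P ?Q h1 d1) (pure K ?P ?Q h2 d2)))
      = lift K (HH (p \<otimes>\<^bsub>Q\<^esub> q)) (hcomul H q g) (\<lambda>g1 g2. pure K ?R ?R (hprod K H p q h1 g1) (hprod K H p q h2 g2))" .
  qed (rule A hopf_intros mult_closed refl | assumption)+
  finally show ?thesis .
qed

lemma lift_hcomul_hprod:
  assumes pq: "p \<in> carrier Q" "q \<in> carrier Q" and h: "h \<in> carrier (hsp H p)" and g: "g \<in> carrier (hsp H q)"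
    and Z: "module K Z" and B: "bilinear_map K (hsp H (p \<otimes>\<^bsub>Q\<^esub> q)) (hsp H (p \<otimes>\<^bsub>Q\<^esub> q)) Z B"
  shows "lift K Z (hcomul H (p \<otimes>\<^bsub>Q\<^esub> q) (hprod K H p q h g)) B =
    lift K Z (hcomul H p h) (\<lambda>h1 h2. lift K Z (hcomul H q g) (\<lambda>g1 g2.
      B (hprod K H p q h1 g1) (hprod K H p q h2 g2)))"
proof -
  note A = assms bilinear_map_left[OF B] bilinear_map_right[OF B] bilinear_map_closed[OF B]
  show ?thesis
    unfolding hcomul_hprod[OF pq h g]
  proof (rule trans[OF lift_of_lift[where A = "hsp H p" and B = "hsp H p"]], goal_cases)
    \<comment> \<open>Goals 1 to 8 are the side conditions of \<open>lift_of_lift\<close>, so goal 9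
      is the equation left by transitivity. For \<open>lift_cong\<close>, here and later, goal 5 is
      bilinearity and goal 6 the pointwise equation.\<close>
    case 9
    show ?case
    proof (rule lift_cong[where V = "hsp H p" and W = "hsp H p"], goal_cases)
      case (6 h1 h2)
      note A = A 6
      show ?case
      proof (rule trans[OF lift_of_lift[where A = "hsp H q" and B = "hsp H q"]], goal_cases)
        case 9
        show ?case
        proof (rule lift_cong[where V = "hsp H q" and W = "hsp H q"], goal_cases)
          case (6 g1 g2)
          show ?case by (rule lift_pure) (rule A 6 hopf_intros mult_closed refl | assumption)+
        qed (rule A hopf_intros mult_closed refl | assumption)+
      qed (rule A hopf_intros mult_closed refl | assumption)+
    qed (rule A hopf_intros mult_closed refl | assumption)+
  qed (rule A hopf_intros mult_closed refl | assumption)+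
qed

lemma coaction_hcomul: "p \<in> carrier Q \<Longrightarrow> linear_coaction K (hsp H p) (hcomul H p) (hsp H p) (hcomul H p)"
  by (intro linear_coaction.intro module_hsp linear_hcomul)

lemma hcomul_coassoc:
  assumes "p \<in> carrier Q" "h \<in> carrier (hsp H p)" "module K Z" "trilinear_map K (hsp H p) (hsp H p) (hsp H p) Z T"
  shows "lift K Z (hcomul H p h) (\<lambda>k c. lift K Z (hcomul H p k) (\<lambda>a b. T a b c)) =
    lift K Z (hcomul H p h) (\<lambda>a k. lift K Z (hcomul H p k) (\<lambda>b c. T a b c))"
  by (rule linear_coaction.comodule_lift_coassoc[OF coaction_hcomul coalgebra_comodule[OF coalgebra_hsp] assms(3,4,2)])
    (rule assms(1))+

lemma bilinear_act:
  assumes "module K (msp M q)" "p \<in> carrier Q"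
    "linear_map K (tensor K (hsp H p) (msp M q)) (msp M (p \<otimes>\<^bsub>Q\<^esub> q)) (mact M p q)"
  shows "bilinear_map K (hsp H p) (msp M q) (msp M (p \<otimes>\<^bsub>Q\<^esub> q)) (act K H M p q)"
  unfolding act_def
  by (rule linear_map_comp[OF assms(3)] hopf_intros assms | assumption)+

end

section \<open>Free Hopf quasimodules\<close>

text \<open>The space \<open>V\<close> is kept arbitrary here and is instantiated with the
  coinvariants by the sublocale \<open>free\<close> further below.\<close>

locale graded_hopf_free = graded_hopf Q K H
  for Q :: "'q monoid" and K :: "'k ring" and H :: "('q, 'k, 'h) hopf_data" +
  fixes V :: "('k, 'v) module"
  assumes module_V: "module K V"
begin

abbreviation "F \<equiv> free_hopf_quasimodule K Q H V"
abbreviation "T q \<equiv> tensor K (hsp H q) V"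

lemma msp_free [simp]: "msp F q = T q"
  by (simp add: free_hopf_quasimodule_def)

lemma module_T: "q \<in> carrier Q \<Longrightarrow> module K (T q)"
  by (rule module_tensor[OF module_hsp module_V])

lemma mact_free:
  "mact F p q t = lift K (T (p \<otimes>\<^bsub>Q\<^esub> q)) t (\<lambda>h s. lift K (T (p \<otimes>\<^bsub>Q\<^esub> q)) s (\<lambda>g v.
     pure K (hsp H (p \<otimes>\<^bsub>Q\<^esub> q)) V (hprod K H p q h g) v))"
  by (simp add: free_hopf_quasimodule_def Let_def)

lemma bilinear_free_action:
  assumes "p \<in> carrier Q" "q \<in> carrier Q"
  shows "bilinear_map K (hsp H p) (T q) (T (p \<otimes>\<^bsub>Q\<^esub> q)) (\<lambda>h s. lift K (T (p \<otimes>\<^bsub>Q\<^esub> q)) s (\<lambda>g v.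
     pure K (hsp H (p \<otimes>\<^bsub>Q\<^esub> q)) V (hprod K H p q h g) v))"
  by (rule assms module_T module_V hopf_intros mult_closed refl | assumption)+

lemma linear_mact_free:
  assumes "p \<in> carrier Q" "q \<in> carrier Q"
  shows "linear_map K (tensor K (hsp H p) (T q)) (T (p \<otimes>\<^bsub>Q\<^esub> q)) (mact F p q)"
  unfolding mact_free
  by (rule linear_lift) (rule assms bilinear_free_action module_T module_hsp mult_closed)+

lemma bilinear_act_free:
  assumes "p \<in> carrier Q" "q \<in> carrier Q"
  shows "bilinear_map K (hsp H p) (T q) (T (p \<otimes>\<^bsub>Q\<^esub> q)) (act K H F p q)"
  using bilinear_act[of F q p] linear_mact_free[OF assms] module_T assms by simp

lemma linear_act_free_left:
  "linear_map K U (hsp H p) f \<Longrightarrow> r = p \<otimes>\<^bsub>Q\<^esub> q \<Longrightarrow> p \<in> carrier Q \<Longrightarrow> q \<in> carrier Q \<Longrightarrow>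
    s \<in> carrier (T q) \<Longrightarrow> linear_map K U (T r) (\<lambda>u. act K H F p q (f u) s)"
  using bilinear_map_left[OF bilinear_act_free] by blast

lemma linear_act_free_right:
  "linear_map K U (T q) f \<Longrightarrow> r = p \<otimes>\<^bsub>Q\<^esub> q \<Longrightarrow> p \<in> carrier Q \<Longrightarrow> q \<in> carrier Q \<Longrightarrow>
    h \<in> carrier (hsp H p) \<Longrightarrow> linear_map K U (T r) (\<lambda>u. act K H F p q h (f u))"
  using bilinear_map_right[OF bilinear_act_free] by blast

lemma act_free_closed: "r = p \<otimes>\<^bsub>Q\<^esub> q \<Longrightarrow> p \<in> carrier Q \<Longrightarrow> q \<in> carrier Q \<Longrightarrow>
    h \<in> carrier (hsp H p) \<Longrightarrow> s \<in> carrier (T q) \<Longrightarrow> act K H F p q h s \<in> carrier (T r)"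
  using bilinear_map_closed[OF bilinear_act_free] by blast

lemma act_free_pure:
  assumes pq: "p \<in> carrier Q" "q \<in> carrier Q" and h: "h \<in> carrier (hsp H p)"
    and gv: "g \<in> carrier (hsp H q)" "v \<in> carrier V"
  shows "act K H F p q h (pure K (hsp H q) V g v) = pure K (hsp H (p \<otimes>\<^bsub>Q\<^esub> q)) V (hprod K H p q h g) v"
proof -
  have "act K H F p q h (pure K (hsp H q) V g v) = lift K (T (p \<otimes>\<^bsub>Q\<^esub> q)) (pure K (hsp H q) V g v) (\<lambda>g v.
     pure K (hsp H (p \<otimes>\<^bsub>Q\<^esub> q)) V (hprod K H p q h g) v)"
    unfolding act_def mact_free msp_free
    by (rule lift_pure) (rule assms bilinear_free_action module_T module_V module_hsp mult_closed pure_closed)+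
  also have "\<dots> = pure K (hsp H (p \<otimes>\<^bsub>Q\<^esub> q)) V (hprod K H p q h g) v"
    by (rule lift_pure) (rule assms module_V hopf_intros mult_closed refl | assumption)+
  finally show ?thesis .
qed

lemma mcoact_free:
  "mcoact F q t = lift K (tensor K (hsp H q) (T q)) t (\<lambda>g v. lift K (tensor K (hsp H q) (T q)) (hcomul H q g)
     (\<lambda>g1 g2. pure K (hsp H q) (T q) g1 (pure K (hsp H q) V g2 v)))"
  by (simp add: free_hopf_quasimodule_def Let_def)

lemma bilinear_free_coaction:
  assumes "q \<in> carrier Q"
  shows "bilinear_map K (hsp H q) V (tensor K (hsp H q) (T q)) (\<lambda>g v. lift K (tensor K (hsp H q) (T q)) (hcomul H q g)
     (\<lambda>g1 g2. pure K (hsp H q) (T q) g1 (pure K (hsp H q) V g2 v)))"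
  by (rule assms module_T module_V hopf_intros | assumption)+

lemma linear_mcoact_free: "q \<in> carrier Q \<Longrightarrow> linear_map K (T q) (tensor K (hsp H q) (T q)) (mcoact F q)"
  unfolding mcoact_free
  by (rule linear_lift) (rule bilinear_free_coaction module_T module_V module_hsp module_tensor | assumption)+

lemma linear_mcoact_free_comp: "linear_map K U (T q) f \<Longrightarrow> q \<in> carrier Q \<Longrightarrow>
    linear_map K U (tensor K (hsp H q) (T q)) (\<lambda>u. mcoact F q (f u))"
  by (rule linear_map_comp[OF linear_mcoact_free])

lemma mcoact_free_closed: "q \<in> carrier Q \<Longrightarrow> s \<in> carrier (T q) \<Longrightarrow> mcoact F q s \<in> carrier (tensor K (hsp H q) (T q))"
  by (rule linear_map_closed[OF linear_mcoact_free])

lemmas free_intros = module_V module_T linear_act_free_left linear_act_free_right act_free_closed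
  linear_mcoact_free_comp mcoact_free_closed hopf_intros mult_closed qinv_closed one_closed refl

lemma mcoact_free_pure:
  assumes "q \<in> carrier Q" "g \<in> carrier (hsp H q)" "v \<in> carrier V"
  shows "mcoact F q (pure K (hsp H q) V g v) = lift K (tensor K (hsp H q) (T q)) (hcomul H q g)
     (\<lambda>g1 g2. pure K (hsp H q) (T q) g1 (pure K (hsp H q) V g2 v))"
  unfolding mcoact_free
  by (rule lift_pure) (rule assms bilinear_free_coaction module_T module_V module_hsp module_tensor)+

lemma lift_mcoact_free_pure:
  assumes "q \<in> carrier Q" "g \<in> carrier (hsp H q)" "v \<in> carrier V" "module K Z" "bilinear_map K (hsp H q) (T q) Z B"
  shows "lift K Z (mcoact F q (pure K (hsp H q) V g v)) B =
    lift K Z (hcomul H q g) (\<lambda>g1 g2. B g1 (pure K (hsp H q) V g2 v))"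
proof -
  note B = assms(5)
  note A = assms bilinear_map_left[OF B] bilinear_map_right[OF B] bilinear_map_closed[OF B]
  show ?thesis unfolding mcoact_free_pure[OF assms(1-3)]
  proof (rule trans[OF lift_of_lift[where A = "hsp H q" and B = "hsp H q"]], goal_cases)
    case 9
    show ?case
    proof (rule lift_cong[where V = "hsp H q" and W = "hsp H q"], goal_cases)
      case (6 a b)
      show ?case by (rule lift_pure) (rule 6 A free_intros | assumption)+
    qed (rule A free_intros | assumption)+
  qed (rule A free_intros | assumption)+
qed

text \<open>The factor \<open>v\<close> is a spectator: identities for sums in H carry over to H
  tensor V by linearity in the first leg.\<close>

lemma lift_pure_left:
  assumes "q \<in> carrier Q" "p \<in> carrier Q" "h \<in> carrier (hsp H p)" "v \<in> carrier V"
    "bilinear_map K (hsp H p) (hsp H p) (hsp H q) B"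
  shows "lift K (T q) (hcomul H p h) (\<lambda>a b. pure K (hsp H q) V (B a b) v) =
    pure K (hsp H q) V (lift K (hsp H q) (hcomul H p h) B) v"
  by (rule linear_map_of_lift[symmetric, where f = "\<lambda>x. pure K (hsp H q) V x v" and V = "hsp H p" and W = "hsp H p"])
    (rule assms free_intros)+

lemma pure_smult_left:
  assumes "q \<in> carrier Q" "a \<in> carrier K" "g \<in> carrier (hsp H q)" "v \<in> carrier V"
  shows "pure K (hsp H q) V (a \<odot>\<^bsub>hsp H q\<^esub> g) v = a \<odot>\<^bsub>T q\<^esub> pure K (hsp H q) V g v"
  by (rule linear_map_smult[where f = "\<lambda>g. pure K (hsp H q) V g v" and V = "hsp H q" and W = "T q"])
    (rule assms free_intros)+

section \<open>The Hopf quasimodule axioms for the free family\<close>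

lemma act_hone_free:
  assumes q: "q \<in> carrier Q" and s: "s \<in> carrier (T q)"
  shows "act K H F \<one>\<^bsub>Q\<^esub> q (hone K H) s = s"
proof (rule tensor_ext[OF module_hsp[OF q] module_V module_T[OF q] _ linear_map_id _ s], goal_cases)
  case (2 g v)
  then show ?case using q by (simp add: act_free_pure hone_closed hone_hprod)
qed (rule q free_intros one_mult[symmetric])+

text \<open>On a pure tensor g \<otimes> v this is the antipode identity h1(S(h2) g) = \<epsilon>(h)
  g tensored with \<open>v\<close>; the nested bracketing of that identity matches the iterated
  action exactly.\<close>

lemma act_anti_right_free:
  assumes p: "p \<in> carrier Q" and q: "q \<in> carrier Q" and h: "h \<in> carrier (hsp H p)" and s: "s \<in> carrier (T q)"
  shows "act_anti_right K Q H F p q h s = hcounit H p h \<odot>\<^bsub>T q\<^esub> s"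
proof -
  note A = p q h
  show ?thesis
    unfolding act_anti_right_def msp_free
  proof (rule tensor_ext[OF module_hsp[OF q] module_V module_T[OF q] _ _ _ s], goal_cases)
    case (3 g v)
    have "lift K (T q) (hcomul H p h) (\<lambda>h1 h2. act K H F p (qinv Q p \<otimes>\<^bsub>Q\<^esub> q) h1
            (act K H F (qinv Q p) q (hanti H p h2) (pure K (hsp H q) V g v))) =
      lift K (T q) (hcomul H p h) (\<lambda>h1 h2. pure K (hsp H q) V
        (hprod K H p (qinv Q p \<otimes>\<^bsub>Q\<^esub> q) h1 (hprod K H (qinv Q p) q (hanti H p h2) g)) v)"
    proof (rule lift_cong[where V = "hsp H p" and W = "hsp H p"], goal_cases)
      case (6 h1 h2)
      then show ?case using A 3 by (simp add: act_free_pure hanti_closed hprod_closed)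
    qed (rule A 3 free_intros | assumption | (simp add: A; fail))+
    also have "\<dots> = pure K (hsp H q) V (hcounit H p h \<odot>\<^bsub>hsp H q\<^esub> g) v"
      unfolding hanti_right[OF A 3(1), symmetric]
      by (rule lift_pure_left) (rule A 3 free_intros | assumption | (simp add: A; fail))+
    also have "\<dots> = hcounit H p h \<odot>\<^bsub>T q\<^esub> pure K (hsp H q) V g v"
      by (rule pure_smult_left) (rule A 3 hopf_intros)+
    finally show ?case .
  qed (rule A free_intros | assumption | (simp add: A; fail))+
qed

text \<open>The same argument, now from the antipode identity S(h1)(h2 g) = \<epsilon>(h) g.\<close>

lemma act_anti_left_free:
  assumes p: "p \<in> carrier Q" and q: "q \<in> carrier Q" and h: "h \<in> carrier (hsp H p)" and s: "s \<in> carrier (T q)"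
  shows "act_anti_left K Q H F p q h s = hcounit H p h \<odot>\<^bsub>T q\<^esub> s"
proof -
  note A = p q h
  show ?thesis
    unfolding act_anti_left_def msp_free
  proof (rule tensor_ext[OF module_hsp[OF q] module_V module_T[OF q] _ _ _ s], goal_cases)
    case (3 g v)
    have "lift K (T q) (hcomul H p h) (\<lambda>h1 h2. act K H F (qinv Q p) (p \<otimes>\<^bsub>Q\<^esub> q) (hanti H p h1)
            (act K H F p q h2 (pure K (hsp H q) V g v))) =
      lift K (T q) (hcomul H p h) (\<lambda>h1 h2. pure K (hsp H q) V
        (hprod K H (qinv Q p) (p \<otimes>\<^bsub>Q\<^esub> q) (hanti H p h1) (hprod K H p q h2 g)) v)"
    proof (rule lift_cong[where V = "hsp H p" and W = "hsp H p"], goal_cases)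
      case (6 h1 h2)
      then show ?case using A 3 by (simp add: act_free_pure hanti_closed hprod_closed)
    qed (rule A 3 free_intros | assumption | (simp add: A; fail))+
    also have "\<dots> = pure K (hsp H q) V (hcounit H p h \<odot>\<^bsub>hsp H q\<^esub> g) v"
      unfolding hanti_left[OF A 3(1), symmetric]
      by (rule lift_pure_left) (rule A 3 free_intros | assumption | (simp add: A; fail))+
    also have "\<dots> = hcounit H p h \<odot>\<^bsub>T q\<^esub> pure K (hsp H q) V g v"
      by (rule pure_smult_left) (rule A 3 hopf_intros)+
    finally show ?case .
  qed (rule A free_intros | assumption | (simp add: A; fail))+
qed

lemma graded_quasimodule_free: "graded_quasimodule K Q H F"
  unfolding graded_quasimodule_def
  by (simp add: module_T linear_mact_free act_hone_free act_anti_right_free act_anti_left_free)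

text \<open>Up to reassociation of tensors the coaction is the comultiplication of H with
  \<open>V\<close> as a spectator, so on pure tensors both axioms reduce to coassociativity and the
  left counit law of H.\<close>

lemma comodule_free:
  assumes q: "q \<in> carrier Q"
  shows "comodule K (hsp H q) (hcomul H q) (hcounit H q) (T q) (mcoact F q)"
  unfolding comodule_def
proof (intro conjI ballI)
  show "linear_map K (T q) (tensor K (hsp H q) (T q)) (mcoact F q)" by (rule linear_mcoact_free[OF q])
  fix m assume m: "m \<in> carrier (T q)"
  let ?Z = "tensor K (hsp H q) (tensor K (hsp H q) (T q))"
  let ?C = "hsp H q"
  interpret linear_coaction K ?C "hcomul H q" "T q" "mcoact F q"
    by (intro linear_coaction.intro module_hsp linear_hcomul linear_mcoact_free module_T q)
  have "lift K ?Z (mcoact F q m) (\<lambda>h x. lift K ?Z (hcomul H q h) (\<lambda>a b. pure K ?C (tensor K ?C (T q)) a (pure K ?C (T q) b x)))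
     = lift K ?Z (mcoact F q m) (\<lambda>h x. pure K ?C (tensor K ?C (T q)) h (mcoact F q x))"
  proof (rule tensor_ext[OF module_hsp[OF q] module_V _ _ _ _ m, where Z = ?Z], goal_cases)
    case (4 g v)
    note A = q 4
    have "lift K ?Z (mcoact F q (pure K ?C V g v)) (\<lambda>h x. lift K ?Z (hcomul H q h) (\<lambda>a b. pure K ?C (tensor K ?C (T q)) a (pure K ?C (T q) b x)))
       = lift K ?Z (hcomul H q g) (\<lambda>h c. lift K ?Z (hcomul H q h) (\<lambda>a b. pure K ?C (tensor K ?C (T q)) a (pure K ?C (T q) b (pure K ?C V c v))))"
      by (rule lift_mcoact_free_pure) (rule A free_intros | assumption)+
    also have "\<dots> = lift K ?Z (hcomul H q g) (\<lambda>a k. lift K ?Z (hcomul H q k) (\<lambda>b c. pure K ?C (tensor K ?C (T q)) a (pure K ?C (T q) b (pure K ?C V c v))))"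
      by (rule hcomul_coassoc) (rule A free_intros | assumption)+
    also have "\<dots> = lift K ?Z (hcomul H q g) (\<lambda>a k. pure K ?C (tensor K ?C (T q)) a (mcoact F q (pure K ?C V k v)))"
    proof (rule lift_cong[where V = ?C and W = ?C], goal_cases)
      case (6 a k)
      show ?case unfolding mcoact_free_pure[OF q 6(2) 4(2)]
        by (rule linear_map_of_lift[symmetric, where f = "pure K ?C (tensor K ?C (T q)) a" and V = ?C and W = ?C])
          (rule A 6 free_intros | assumption)+
    qed (rule A free_intros | assumption)+
    also have "\<dots> = lift K ?Z (mcoact F q (pure K ?C V g v)) (\<lambda>h x. pure K ?C (tensor K ?C (T q)) h (mcoact F q x))"
      by (rule lift_mcoact_free_pure[symmetric]) (rule A free_intros | assumption)+
    finally show ?case .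
  qed (rule q free_intros | assumption)+
  then show "tensor_assoc K ?C ?C (T q) (tensor_map K (tensor K ?C ?C) (T q) (hcomul H q) (\<lambda>x. x) (mcoact F q m))
      = tensor_map K ?C (tensor K ?C (T q)) (\<lambda>x. x) (mcoact F q) (mcoact F q m)"
    unfolding tensor_assoc_comult[OF mcoact_free_closed[OF q m]] by (simp only: tensor_map_def)
  show "lift K (T q) (mcoact F q m) (\<lambda>c x. hcounit H q c \<odot>\<^bsub>T q\<^esub> x) = m"
  proof (rule tensor_ext[OF module_hsp[OF q] module_V module_T[OF q] _ linear_map_id _ m], goal_cases)
    case (2 g v)
    note A = q 2
    have "lift K (T q) (mcoact F q (pure K ?C V g v)) (\<lambda>c x. hcounit H q c \<odot>\<^bsub>T q\<^esub> x)
      = lift K (T q) (hcomul H q g) (\<lambda>a b. hcounit H q a \<odot>\<^bsub>T q\<^esub> pure K ?C V b v)"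
      by (rule lift_mcoact_free_pure) (rule A free_intros | assumption)+
    also have "\<dots> = lift K (T q) (hcomul H q g) (\<lambda>a b. pure K ?C V (hcounit H q a \<odot>\<^bsub>?C\<^esub> b) v)"
      by (rule lift_cong[where V = ?C and W = ?C]) (rule A free_intros pure_smult_left[symmetric] | assumption)+
    also have "\<dots> = pure K ?C V (lift K ?C (hcomul H q g) (\<lambda>a b. hcounit H q a \<odot>\<^bsub>?C\<^esub> b)) v"
      by (rule lift_pure_left) (rule A free_intros | assumption)+
    finally show ?case by (simp add: hcounit_left A)
  qed (rule q free_intros | assumption)+
qed

text \<open>On h and g \<otimes> v the claim is multiplicativity of the comultiplication, with (hg)1
  = h1 g1 and (hg)2 = h2 g2, carried along with \<open>v\<close>.\<close>

lemma mcoact_act_free: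
  assumes p: "p \<in> carrier Q" and q: "q \<in> carrier Q" and h: "h \<in> carrier (hsp H p)" and m: "m \<in> carrier (T q)"
  shows "mcoact F (p \<otimes>\<^bsub>Q\<^esub> q) (act K H F p q h m) =
    lift K (tensor K (hsp H (p \<otimes>\<^bsub>Q\<^esub> q)) (T (p \<otimes>\<^bsub>Q\<^esub> q))) (hcomul H p h) (\<lambda>h1 h2.
      lift K (tensor K (hsp H (p \<otimes>\<^bsub>Q\<^esub> q)) (T (p \<otimes>\<^bsub>Q\<^esub> q))) (mcoact F q m) (\<lambda>m1 m0.
        pure K (hsp H (p \<otimes>\<^bsub>Q\<^esub> q)) (T (p \<otimes>\<^bsub>Q\<^esub> q)) (hprod K H p q h1 m1) (act K H F p q h2 m0)))"
proof (rule tensor_ext[OF module_hsp[OF q] module_V _ _ _ _ m,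
      where Z = "tensor K (hsp H (p \<otimes>\<^bsub>Q\<^esub> q)) (T (p \<otimes>\<^bsub>Q\<^esub> q))"], goal_cases)
  case (4 g v)
  note A = p q h 4
  let ?R = "hsp H (p \<otimes>\<^bsub>Q\<^esub> q)" and ?S = "T (p \<otimes>\<^bsub>Q\<^esub> q)"
  let ?Z = "tensor K ?R ?S"
  have "mcoact F (p \<otimes>\<^bsub>Q\<^esub> q) (act K H F p q h (pure K (hsp H q) V g v)) =
    lift K ?Z (hcomul H (p \<otimes>\<^bsub>Q\<^esub> q) (hprod K H p q h g)) (\<lambda>g1 g2. pure K ?R ?S g1 (pure K ?R V g2 v))"
    unfolding act_free_pure[OF A]
    by (rule mcoact_free_pure) (rule A free_intros)+
  also have "\<dots> = lift K ?Z (hcomul H p h) (\<lambda>h1 h2. lift K ?Z (hcomul H q g) (\<lambda>g1 g2.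
      pure K ?R ?S (hprod K H p q h1 g1) (pure K ?R V (hprod K H p q h2 g2) v)))"
    by (rule lift_hcomul_hprod) (rule A free_intros | assumption)+
  also have "\<dots> = lift K ?Z (hcomul H p h) (\<lambda>h1 h2. lift K ?Z (mcoact F q (pure K (hsp H q) V g v)) (\<lambda>m1 m0.
        pure K ?R ?S (hprod K H p q h1 m1) (act K H F p q h2 m0)))"
  proof (rule lift_cong[where V = "hsp H p" and W = "hsp H p"], goal_cases)
    case (6 h1 h2)
    have "lift K ?Z (hcomul H q g) (\<lambda>g1 g2. pure K ?R ?S (hprod K H p q h1 g1) (pure K ?R V (hprod K H p q h2 g2) v))
      = lift K ?Z (hcomul H q g) (\<lambda>g1 g2. pure K ?R ?S (hprod K H p q h1 g1) (act K H F p q h2 (pure K (hsp H q) V g2 v)))"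
    proof (rule lift_cong[where V = "hsp H q" and W = "hsp H q"], goal_cases)
      case prems: (6 g1 g2)
      show ?case using prems 6 A by (simp add: act_free_pure)
    qed (rule A 6 free_intros | assumption)+
    also have "\<dots> = lift K ?Z (mcoact F q (pure K (hsp H q) V g v)) (\<lambda>m1 m0.
        pure K ?R ?S (hprod K H p q h1 m1) (act K H F p q h2 m0))"
      by (rule lift_mcoact_free_pure[symmetric]) (rule A 6 free_intros | assumption)+
    finally show ?case .
  qed (rule A free_intros | assumption)+
  finally show ?case .
qed (rule p q h free_intros | assumption)+

lemma graded_hopf_quasimodule_free: "graded_hopf_quasimodule K Q H F"
  unfolding graded_hopf_quasimodule_def Let_def
  using graded_quasimodule_free comodule_free mcoact_act_free by (simp only: msp_free) blast

end

section \<open>The projection to the coinvariants\<close>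

locale graded_hopf_module = graded_hopf Q K H
  for Q :: "'q monoid" and K :: "'k ring" and H :: "('q, 'k, 'h) hopf_data" +
  fixes M :: "('q, 'k, 'h, 'm) hopf_quasimod_data"
  assumes hopf_quasimodule: "graded_hopf_quasimodule K Q H M"
begin

abbreviation "e \<equiv> \<one>\<^bsub>Q\<^esub>"
abbreviation "V \<equiv> coinvariants K Q H M"
abbreviation "HM q \<equiv> tensor K (hsp H q) (msp M q)"

lemma module_msp: "q \<in> carrier Q \<Longrightarrow> module K (msp M q)"
  and linear_mact: "p \<in> carrier Q \<Longrightarrow> q \<in> carrier Q \<Longrightarrow>
    linear_map K (tensor K (hsp H p) (msp M q)) (msp M (p \<otimes>\<^bsub>Q\<^esub> q)) (mact M p q)"
  and act_anti_right_eq: "p \<in> carrier Q \<Longrightarrow> q \<in> carrier Q \<Longrightarrow> h \<in> carrier (hsp H p) \<Longrightarrow> m \<in> carrier (msp M q) \<Longrightarrow>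
    act_anti_right K Q H M p q h m = hcounit H p h \<odot>\<^bsub>msp M q\<^esub> m"
  and act_anti_left_eq: "p \<in> carrier Q \<Longrightarrow> q \<in> carrier Q \<Longrightarrow> h \<in> carrier (hsp H p) \<Longrightarrow> m \<in> carrier (msp M q) \<Longrightarrow>
    act_anti_left K Q H M p q h m = hcounit H p h \<odot>\<^bsub>msp M q\<^esub> m"
  using hopf_quasimodule unfolding graded_hopf_quasimodule_def graded_quasimodule_def by blast+

lemma comodule_msp: "q \<in> carrier Q \<Longrightarrow> comodule K (hsp H q) (hcomul H q) (hcounit H q) (msp M q) (mcoact M q)"
  and mcoact_act: "p \<in> carrier Q \<Longrightarrow> q \<in> carrier Q \<Longrightarrow> h \<in> carrier (hsp H p) \<Longrightarrow> m \<in> carrier (msp M q) \<Longrightarrow>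
    mcoact M (p \<otimes>\<^bsub>Q\<^esub> q) (act K H M p q h m) =
      lift K (HM (p \<otimes>\<^bsub>Q\<^esub> q)) (hcomul H p h) (\<lambda>h1 h2. lift K (HM (p \<otimes>\<^bsub>Q\<^esub> q)) (mcoact M q m) (\<lambda>m1 m0.
        pure K (hsp H (p \<otimes>\<^bsub>Q\<^esub> q)) (msp M (p \<otimes>\<^bsub>Q\<^esub> q)) (hprod K H p q h1 m1) (act K H M p q h2 m0)))"
  using hopf_quasimodule unfolding graded_hopf_quasimodule_def Let_def by blast+

lemma linear_mcoact: "q \<in> carrier Q \<Longrightarrow> linear_map K (msp M q) (HM q) (mcoact M q)"
  and mcoact_counit: "q \<in> carrier Q \<Longrightarrow> m \<in> carrier (msp M q) \<Longrightarrow>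
    lift K (msp M q) (mcoact M q m) (\<lambda>h x. hcounit H q h \<odot>\<^bsub>msp M q\<^esub> x) = m"
  using comodule_msp unfolding comodule_def by blast+

lemma bilinear_act_msp: "p \<in> carrier Q \<Longrightarrow> q \<in> carrier Q \<Longrightarrow>
    bilinear_map K (hsp H p) (msp M q) (msp M (p \<otimes>\<^bsub>Q\<^esub> q)) (act K H M p q)"
  by (rule bilinear_act[OF module_msp _ linear_mact])

lemma linear_act_left:
  "linear_map K U (hsp H p) f \<Longrightarrow> r = p \<otimes>\<^bsub>Q\<^esub> q \<Longrightarrow> p \<in> carrier Q \<Longrightarrow> q \<in> carrier Q \<Longrightarrow>
    m \<in> carrier (msp M q) \<Longrightarrow> linear_map K U (msp M r) (\<lambda>u. act K H M p q (f u) m)"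
  using bilinear_map_left[OF bilinear_act_msp] by blast

lemma linear_act_right:
  "linear_map K U (msp M q) f \<Longrightarrow> r = p \<otimes>\<^bsub>Q\<^esub> q \<Longrightarrow> p \<in> carrier Q \<Longrightarrow> q \<in> carrier Q \<Longrightarrow>
    h \<in> carrier (hsp H p) \<Longrightarrow> linear_map K U (msp M r) (\<lambda>u. act K H M p q h (f u))"
  using bilinear_map_right[OF bilinear_act_msp] by blast

lemma act_closed: "r = p \<otimes>\<^bsub>Q\<^esub> q \<Longrightarrow> p \<in> carrier Q \<Longrightarrow> q \<in> carrier Q \<Longrightarrow>
    h \<in> carrier (hsp H p) \<Longrightarrow> m \<in> carrier (msp M q) \<Longrightarrow> act K H M p q h m \<in> carrier (msp M r)"
  using bilinear_map_closed[OF bilinear_act_msp] by blast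

lemma linear_mcoact_comp: "linear_map K U (msp M q) f \<Longrightarrow> q \<in> carrier Q \<Longrightarrow>
    linear_map K U (HM q) (\<lambda>u. mcoact M q (f u))"
  by (rule linear_map_comp[OF linear_mcoact])

lemma mcoact_closed: "q \<in> carrier Q \<Longrightarrow> m \<in> carrier (msp M q) \<Longrightarrow> mcoact M q m \<in> carrier (HM q)"
  by (rule linear_map_closed[OF linear_mcoact])

lemmas module_intros = module_msp linear_act_left linear_act_right act_closed linear_mcoact_comp mcoact_closed
  hopf_intros mult_closed qinv_closed one_closed refl

lemma mcoact_coassoc:
  assumes "q \<in> carrier Q" "m \<in> carrier (msp M q)" "module K Z" "trilinear_map K (hsp H q) (hsp H q) (msp M q) Z T"
  shows "lift K Z (mcoact M q m) (\<lambda>h x. lift K Z (hcomul H q h) (\<lambda>a b. T a b x)) =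
    lift K Z (mcoact M q m) (\<lambda>a y. lift K Z (mcoact M q y) (\<lambda>b x. T a b x))"
  by (rule linear_coaction.comodule_lift_coassoc[OF linear_coaction.intro comodule_msp assms(3,4,2)])
    (rule assms module_hsp module_msp linear_hcomul linear_mcoact)+

text \<open>This is the map E of the overview, with the degree \<open>q\<close> of its argument made
  explicit.\<close>

definition proj :: "'q \<Rightarrow> 'm \<Rightarrow> 'm" where
  "proj q m = lift K (msp M e) (mcoact M q m) (\<lambda>h x. act K H M (qinv Q q) q (hanti H q h) x)"

lemma linear_proj:
  assumes q: "q \<in> carrier Q" shows "linear_map K (msp M q) (msp M e) (proj q)"
  unfolding proj_def by (rule q module_intros qinv_mult[symmetric] | assumption)+

lemma linear_proj_comp: "linear_map K U (msp M q) f \<Longrightarrow> q \<in> carrier Q \<Longrightarrow>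
    linear_map K U (msp M e) (\<lambda>u. proj q (f u))"
  by (rule linear_map_comp[OF linear_proj])

lemma proj_closed: "q \<in> carrier Q \<Longrightarrow> m \<in> carrier (msp M q) \<Longrightarrow> proj q m \<in> carrier (msp M e)"
  by (rule linear_map_closed[OF linear_proj])

lemmas proj_intros = linear_proj_comp proj_closed module_intros qinv_mult[symmetric] mult_qinv[symmetric]
  mult_one[symmetric]

text \<open>Coassociativity turns the second coaction into a comultiplication of the first leg. The
  summand becomes h1 \<cdot> (S(h2) \<cdot> x) = \<epsilon>(h) x, and the counit law of the comodule
  recovers \<open>m\<close>.\<close>

lemma act_proj:
  assumes q: "q \<in> carrier Q" and m: "m \<in> carrier (msp M q)"
  shows "lift K (msp M q) (mcoact M q m) (\<lambda>h x. act K H M q e h (proj q x)) = m"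
proof -
  let ?M = "msp M q" and ?H = "hsp H q"
  have "lift K ?M (mcoact M q m) (\<lambda>h x. act K H M q e h (proj q x)) =
    lift K ?M (mcoact M q m) (\<lambda>a y. lift K ?M (mcoact M q y) (\<lambda>b x. act K H M q e a (act K H M (qinv Q q) q (hanti H q b) x)))"
  proof (rule lift_cong[where V = ?H and W = ?M], goal_cases)
    case (6 a y)
    show ?case unfolding proj_def
      by (rule linear_map_of_lift[where f = "act K H M q e a" and V = ?H and W = ?M])
        (rule q m 6 proj_intros | assumption)+
  qed (rule q m proj_intros | assumption)+
  also have "\<dots> = lift K ?M (mcoact M q m) (\<lambda>h x. lift K ?M (hcomul H q h) (\<lambda>a b. act K H M q e a (act K H M (qinv Q q) q (hanti H q b) x)))"
    by (rule mcoact_coassoc[symmetric]) (rule q m proj_intros | assumption)+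
  also have "\<dots> = lift K ?M (mcoact M q m) (\<lambda>h x. hcounit H q h \<odot>\<^bsub>?M\<^esub> x)"
  proof (rule lift_cong[where V = ?H and W = ?M], goal_cases)
    case (6 h x)
    show ?case using act_anti_right_eq[OF q q 6] q by (simp add: act_anti_right_def)
  qed (rule q m proj_intros | assumption)+
  also have "\<dots> = m" by (rule mcoact_counit[OF q m])
  finally show ?thesis .
qed

lemma smult_pure_left:
  assumes "module K A" "module K B" "c \<in> carrier K" "a \<in> carrier A" "b \<in> carrier B"
  shows "pure K A B (c \<odot>\<^bsub>A\<^esub> a) b = c \<odot>\<^bsub>tensor K A B\<^esub> pure K A B a b"
  by (rule linear_map_smult[where f = "\<lambda>a. pure K A B a b" and V = A and W = "tensor K A B"])
    (rule assms linear_intros)+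

lemma smult_pure_right:
  assumes "module K A" "module K B" "c \<in> carrier K" "a \<in> carrier A" "b \<in> carrier B"
  shows "pure K A B a (c \<odot>\<^bsub>B\<^esub> b) = c \<odot>\<^bsub>tensor K A B\<^esub> pure K A B a b"
  by (rule linear_map_smult[where f = "\<lambda>b. pure K A B a b" and V = B and W = "tensor K A B"])
    (rule assms linear_intros)+

text \<open>An antipode identity of H in the first leg, with \<open>y\<close> as spectator. The
  extra factor \<open>a\<close> is present because the identity cancels S(h) against g only in front
  of a further factor.\<close>

lemma hanti_cancel_pure:
  assumes q: "q \<in> carrier Q" and l: "l \<in> carrier (hsp H q)" and a: "a \<in> carrier (hsp H e)" and y: "y \<in> carrier (msp M e)"
  shows "lift K (HM e) (hcomul H q l) (\<lambda>h g. pure K (hsp H e) (msp M e) (hprod K H (qinv Q q) q (hanti H q h) (hprod K H q e g a)) y)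
    = hcounit H q l \<odot>\<^bsub>HM e\<^esub> pure K (hsp H e) (msp M e) a y"
proof -
  have "lift K (HM e) (hcomul H q l) (\<lambda>h g. pure K (hsp H e) (msp M e) (hprod K H (qinv Q q) q (hanti H q h) (hprod K H q e g a)) y)
    = pure K (hsp H e) (msp M e) (lift K (hsp H e) (hcomul H q l) (\<lambda>h g. hprod K H (qinv Q q) q (hanti H q h) (hprod K H q e g a))) y"
    by (rule linear_map_of_lift[symmetric, where f = "\<lambda>x. pure K (hsp H e) (msp M e) x y" and V = "hsp H q" and W = "hsp H q"])
      (rule assms proj_intros | assumption)+
  also have "\<dots> = pure K (hsp H e) (msp M e) (hcounit H q l \<odot>\<^bsub>hsp H e\<^esub> a) y"
    using hanti_left[OF q one_closed l a] q by simp
  also have "\<dots> = hcounit H q l \<odot>\<^bsub>HM e\<^esub> pure K (hsp H e) (msp M e) a y"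
    by (rule smult_pure_left) (rule assms proj_intros)+
  finally show ?thesis .
qed

text \<open>The innermost pair must go first: S(h2)(h3 a) = \<epsilon>(l) a removes the factors
  between h1 and h4, after which S(h1) \<cdot> (h4 \<cdot> b) cancels in the second leg. The
  statement is linear in \<open>t\<close>, so it suffices to take t = a \<otimes> b.\<close>

lemma coaction_cancel:
  assumes q: "q \<in> carrier Q" and h: "h \<in> carrier (hsp H q)" and t: "t \<in> carrier (HM e)"
  shows "lift K (HM e) (hcomul H q h) (\<lambda>h1 k. lift K (HM e) (hcomul H q k) (\<lambda>l h4. lift K (HM e) (hcomul H q l) (\<lambda>h2 h3.
      lift K (HM e) t (\<lambda>a b. pure K (hsp H e) (msp M e) (hprod K H (qinv Q q) q (hanti H q h2) (hprod K H q e h3 a))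
        (act K H M (qinv Q q) q (hanti H q h1) (act K H M q e h4 b)))))) = hcounit H q h \<odot>\<^bsub>HM e\<^esub> t"
proof (rule tensor_ext[OF module_hsp[OF one_closed] module_msp[OF one_closed] _ _ _ _ t, where Z = "HM e"], goal_cases)
  case (4 a b)
  note A = q h 4
  let ?H = "hsp H q" and ?P = "pure K (hsp H e) (msp M e)"
  let ?S = "\<lambda>h1 h4. act K H M (qinv Q q) q (hanti H q h1) (act K H M q e h4 b)"
  let ?R = "\<lambda>h2 h3. hprod K H (qinv Q q) q (hanti H q h2) (hprod K H q e h3 a)"
  have "lift K (HM e) (hcomul H q h) (\<lambda>h1 k. lift K (HM e) (hcomul H q k) (\<lambda>l h4. lift K (HM e) (hcomul H q l) (\<lambda>h2 h3.
      lift K (HM e) (?P a b) (\<lambda>a b. ?P (hprod K H (qinv Q q) q (hanti H q h2) (hprod K H q e h3 a))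
        (act K H M (qinv Q q) q (hanti H q h1) (act K H M q e h4 b)))))) =
    lift K (HM e) (hcomul H q h) (\<lambda>h1 k. lift K (HM e) (hcomul H q k) (\<lambda>l h4. hcounit H q l \<odot>\<^bsub>HM e\<^esub> ?P a (?S h1 h4)))"
  proof (rule lift_cong[where V = ?H and W = ?H], goal_cases)
    case prems1: (6 h1 k)
    show ?case
    proof (rule lift_cong[where V = ?H and W = ?H], goal_cases)
      case prems2: (6 l h4)
      have "lift K (HM e) (hcomul H q l) (\<lambda>h2 h3.
          lift K (HM e) (?P a b) (\<lambda>a b. ?P (hprod K H (qinv Q q) q (hanti H q h2) (hprod K H q e h3 a))
          (act K H M (qinv Q q) q (hanti H q h1) (act K H M q e h4 b)))) =
        lift K (HM e) (hcomul H q l) (\<lambda>h2 h3. ?P (?R h2 h3) (?S h1 h4))"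
      proof (rule lift_cong[where V = ?H and W = ?H], goal_cases)
        case (6 h2 h3)
        show ?case by (rule lift_pure) (rule A prems1 prems2 6 proj_intros | assumption)+
      qed (rule A prems1 prems2 proj_intros | assumption)+
      also have "\<dots> = hcounit H q l \<odot>\<^bsub>HM e\<^esub> ?P a (?S h1 h4)"
        by (rule hanti_cancel_pure) (rule A prems1 prems2 proj_intros | assumption)+
      finally show ?case .
    qed (rule A prems1 proj_intros | assumption)+
  qed (rule A proj_intros | assumption)+
  \<comment> \<open>The scalar \<epsilon>(l) moves onto h4, and the left counit law contracts the
    comultiplication of \<open>k\<close>, leaving \<open>k\<close> in the place of h4.\<close>
  also have "\<dots> = lift K (HM e) (hcomul H q h) (\<lambda>h1 k. ?P a (?S h1 k))"
  proof (rule lift_cong[where V = ?H and W = ?H], goal_cases)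
    case prems1: (6 h1 k)
    let ?f = "\<lambda>k. ?P a (?S h1 k)"
    have f: "linear_map K ?H (HM e) ?f" by (rule A prems1 proj_intros | assumption)+
    have "lift K (HM e) (hcomul H q k) (\<lambda>l h4. hcounit H q l \<odot>\<^bsub>HM e\<^esub> ?f h4) =
      lift K (HM e) (hcomul H q k) (\<lambda>l h4. ?f (hcounit H q l \<odot>\<^bsub>?H\<^esub> h4))"
    proof (rule lift_cong[where V = ?H and W = ?H], goal_cases)
      case (6 l h4)
      show ?case using linear_map_smult[OF f] hcounit_closed[OF q] 6 by simp
    next
      case 5
      show ?case
        by (intro bilinear_mapI linear_map_comp[OF f]) (rule A prems1 proj_intros | assumption)+
    qed (rule A prems1 proj_intros | assumption)+
    also have "\<dots> = ?f (lift K ?H (hcomul H q k) (\<lambda>l h4. hcounit H q l \<odot>\<^bsub>?H\<^esub> h4))"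
      by (rule linear_map_of_lift[symmetric, where f = ?f and V = ?H and W = ?H]) (rule f A prems1 proj_intros | assumption)+
    also have "\<dots> = ?f k" by (simp add: hcounit_left[OF q prems1(2)])
    finally show ?case .
  qed (rule A proj_intros | assumption)+
  also have "\<dots> = ?P a (lift K (msp M e) (hcomul H q h) ?S)"
    by (rule linear_map_of_lift[symmetric, where f = "?P a" and V = ?H and W = ?H]) (rule A proj_intros | assumption)+
  also have "\<dots> = ?P a (hcounit H q h \<odot>\<^bsub>msp M e\<^esub> b)"
    using act_anti_left_eq[OF q one_closed h 4(2)] q by (simp add: act_anti_left_def)
  also have "\<dots> = hcounit H q h \<odot>\<^bsub>HM e\<^esub> ?P a b"
    by (rule smult_pure_right) (rule A proj_intros)+
  finally show ?case .
qed (rule q h proj_intros | assumption)+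


text \<open>
  Coinvariance of the projection is obtained by evaluating the sum of the
  \<open>S(m\<^sub>(\<^sub>-\<^sub>2\<^sub>)) m\<^sub>(\<^sub>-\<^sub>1\<^sub>) \<otimes> S(m\<^sub>(\<^sub>-\<^sub>3\<^sub>)) \<cdot> m\<^sub>(\<^sub>0\<^sub>)\<close> in two ways: directly, and after expanding
  \<open>m\<^sub>(\<^sub>0\<^sub>)\<close> as \<open>m\<^sub>(\<^sub>-\<^sub>1\<^sub>) \<cdot> E(m\<^sub>(\<^sub>0\<^sub>))\<close>. This avoids the anticomultiplicativity of the antipode.
\<close>

lemma mcoact_proj:
  assumes q: "q \<in> carrier Q" and m: "m \<in> carrier (msp M q)"
  shows "mcoact M e (proj q m) = pure K (hsp H e) (msp M e) (hone K H) (proj q m)"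
proof -
  let ?H = "hsp H q" and ?M = "msp M q" and ?Z = "HM e"
  let ?P = "pure K (hsp H e) (msp M e)" and ?S = "hanti H q"
  let ?L = "\<lambda>t B. lift K ?Z t B" and ?\<Delta> = "hcomul H q" and ?\<rho> = "mcoact M q"
  \<comment> \<open>The variables h1, h2, g, y stand for the legs m(-3), m(-2), m(-1), m(0) of the
    iterated coaction. In \<open>?W\<close> the pair g \<otimes> y has become the coaction of g
    acting on a degree-e element whose own coaction is \<open>t\<close>.\<close>
  let ?B = "\<lambda>h1 h2 g y. ?P (hprod K H (qinv Q q) q (?S h2) g) (act K H M (qinv Q q) q (?S h1) y)"
  let ?W = "\<lambda>h1 h2 g1 g2 t. ?L t (\<lambda>a b. ?P (hprod K H (qinv Q q) q (?S h2) (hprod K H q e g1 a))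
        (act K H M (qinv Q q) q (?S h1) (act K H M q e g2 b)))"
  let ?A = "?L (?\<rho> m) (\<lambda>h1 x. ?L (?\<rho> x) (\<lambda>h2 x'. ?L (?\<rho> x') (?B h1 h2)))"
  note A = q m
  have "?A = ?L (?\<rho> m) (\<lambda>h1 x. ?P (hone K H) (act K H M (qinv Q q) q (?S h1) x))"
  proof (rule lift_cong[where V = ?H and W = ?M], goal_cases)
    case (6 h1 x)
    let ?f = "\<lambda>y. ?P (hone K H) (act K H M (qinv Q q) q (?S h1) y)"
    have f: "linear_map K ?M ?Z ?f" by (rule A 6 proj_intros | assumption)+
    have "?L (?\<rho> x) (\<lambda>h2 x'. ?L (?\<rho> x') (\<lambda>g y. ?B h1 h2 g y)) = ?L (?\<rho> x) (\<lambda>k y. ?L (?\<Delta> k) (\<lambda>h2 g. ?B h1 h2 g y))"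
      by (rule mcoact_coassoc[symmetric]) (rule A 6 proj_intros | assumption)+
    also have "\<dots> = ?L (?\<rho> x) (\<lambda>k y. ?f (hcounit H q k \<odot>\<^bsub>?M\<^esub> y))"
    proof (rule lift_cong[where V = ?H and W = ?M], goal_cases)
      case prems: (6 k y)
      \<comment> \<open>Writing g as g times the unit brings S(h2) g into the shape of
        \<open>hanti_cancel_pure\<close> with the unit as extra factor.\<close>
      have "?L (?\<Delta> k) (\<lambda>h2 g. ?B h1 h2 g y) = ?L (?\<Delta> k) (\<lambda>h2 g.
          ?P (hprod K H (qinv Q q) q (?S h2) (hprod K H q e g (hone K H))) (act K H M (qinv Q q) q (?S h1) y))"
      proof (rule lift_cong[where V = ?H and W = ?H], goal_cases)
        case (6 h2 g)
        then show ?case using q by (simp add: hprod_hone)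
      qed (rule A 6 prems proj_intros | assumption)+
      also have "\<dots> = hcounit H q k \<odot>\<^bsub>?Z\<^esub> ?f y"
        by (rule hanti_cancel_pure) (rule A 6 prems proj_intros | assumption)+
      also have "\<dots> = ?f (hcounit H q k \<odot>\<^bsub>?M\<^esub> y)"
        using linear_map_smult[OF f] hcounit_closed[OF q] prems by simp
      finally show ?case .
    next
      case 5
      show ?case by (intro bilinear_mapI linear_map_comp[OF f]) (rule A 6 proj_intros | assumption)+
    qed (rule A 6 proj_intros | assumption)+
    also have "\<dots> = ?f (lift K ?M (?\<rho> x) (\<lambda>k y. hcounit H q k \<odot>\<^bsub>?M\<^esub> y))"
      by (rule linear_map_of_lift[symmetric, where f = ?f and V = ?H and W = ?M]) (rule f A 6 proj_intros | assumption)+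
    also have "\<dots> = ?f x" by (simp add: mcoact_counit[OF q 6(2)])
    finally show ?case .
  qed (rule A proj_intros | assumption)+
  also have "\<dots> = ?P (hone K H) (proj q m)"
    unfolding proj_def
    by (rule linear_map_of_lift[symmetric, where f = "?P (hone K H)" and V = ?H and W = ?M]) (rule A proj_intros | assumption)+
  finally have 1: "?A = ?P (hone K H) (proj q m)" .
  \<comment> \<open>Second evaluation: replace x by x(-1) \<cdot> E(x(0)) through
    \<open>act_proj\<close>, then open the coaction of g \<cdot> E(y) by the compatibility axiom in
    degree qe = q. Both legs acquire the nested shape required for cancellation.\<close>
  have expand: "?L (?\<rho> x) (?B h1 h2) = ?L (?\<rho> x) (\<lambda>g y. ?L (?\<Delta> g) (\<lambda>g1 g2. ?W h1 h2 g1 g2 (mcoact M e (proj q y))))"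
    if h: "h1 \<in> carrier ?H" "h2 \<in> carrier ?H" and x: "x \<in> carrier ?M" for h1 h2 x
  proof -
    let ?f = "\<lambda>x. ?L (?\<rho> x) (?B h1 h2)"
    have "?f x = ?f (lift K ?M (?\<rho> x) (\<lambda>g y. act K H M q e g (proj q y)))"
      by (simp add: act_proj[OF q x])
    also have "\<dots> = ?L (?\<rho> x) (\<lambda>g y. ?f (act K H M q e g (proj q y)))"
      by (rule linear_map_of_lift[where f = ?f and V = ?H and W = ?M]) (rule A h x proj_intros | assumption)+
    also have "\<dots> = ?L (?\<rho> x) (\<lambda>g y. ?L (?\<Delta> g) (\<lambda>g1 g2. ?W h1 h2 g1 g2 (mcoact M e (proj q y))))"
    proof (rule lift_cong[where V = ?H and W = ?M], goal_cases)
      case prems: (6 g y)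
      note p = proj_closed[OF q prems(2)]
      have "?\<rho> (act K H M q e g (proj q y)) = lift K (HM q) (?\<Delta> g) (\<lambda>h1 h2. lift K (HM q) (mcoact M e (proj q y)) (\<lambda>m1 m0.
        pure K ?H ?M (hprod K H q e h1 m1) (act K H M q e h2 m0)))"
        using mcoact_act[OF q one_closed prems(1) p] q by simp
      then have "?f (act K H M q e g (proj q y)) = ?L (lift K (HM q) (?\<Delta> g) (\<lambda>h1 h2. lift K (HM q) (mcoact M e (proj q y)) (\<lambda>m1 m0.
        pure K ?H ?M (hprod K H q e h1 m1) (act K H M q e h2 m0)))) (?B h1 h2)" by simp
      also have "\<dots> = ?L (?\<Delta> g) (\<lambda>g1 g2. ?L (lift K (HM q) (mcoact M e (proj q y)) (\<lambda>m1 m0.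
        pure K ?H ?M (hprod K H q e g1 m1) (act K H M q e g2 m0))) (?B h1 h2))"
        by (rule lift_of_lift) (rule A h prems proj_intros | assumption)+
      also have "\<dots> = ?L (?\<Delta> g) (\<lambda>g1 g2. ?W h1 h2 g1 g2 (mcoact M e (proj q y)))"
      proof (rule lift_cong[where V = ?H and W = ?H], goal_cases)
        case prems1: (6 g1 g2)
        have "?L (lift K (HM q) (mcoact M e (proj q y)) (\<lambda>m1 m0.
            pure K ?H ?M (hprod K H q e g1 m1) (act K H M q e g2 m0))) (?B h1 h2)
          = ?L (mcoact M e (proj q y)) (\<lambda>m1 m0. ?L (pure K ?H ?M (hprod K H q e g1 m1) (act K H M q e g2 m0)) (?B h1 h2))"
          by (rule lift_of_lift) (rule A h prems prems1 proj_intros | assumption)+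
        also have "\<dots> = ?W h1 h2 g1 g2 (mcoact M e (proj q y))"
        proof (rule lift_cong[where V = "hsp H e" and W = "msp M e"], goal_cases)
          case (6 a b)
          show ?case by (rule lift_pure) (rule A h prems prems1 6 proj_intros | assumption)+
        qed (rule A h prems prems1 proj_intros | assumption)+
        finally show ?case .
      qed (rule A h prems proj_intros | assumption)+
      finally show ?case .
    qed (rule A h x proj_intros | assumption)+
    finally show ?thesis .
  qed
  have "?A = ?L (?\<rho> m) (\<lambda>h1 x. ?L (?\<rho> x) (\<lambda>h2 x'. ?L (?\<rho> x') (\<lambda>g y. ?L (?\<Delta> g) (\<lambda>g1 g2. ?W h1 h2 g1 g2 (mcoact M e (proj q y))))))"
  proof (rule lift_cong[where V = ?H and W = ?M], goal_cases)
    case prems: (6 h1 x)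
    show ?case
    proof (rule lift_cong[where V = ?H and W = ?M], goal_cases)
      case (6 h2 x')
      show ?case by (rule expand[OF prems(1) 6])
    qed (rule A prems proj_intros | assumption)+
  qed (rule A proj_intros | assumption)+
  \<comment> \<open>Regrouping makes h2 and g1, the neighbours to be cancelled first, the two halves
    of one comultiplication. The next regrouping collects h1 as well, giving the nesting of
    \<open>coaction_cancel\<close>.\<close>
  also have "\<dots> = ?L (?\<rho> m) (\<lambda>h1 x. ?L (?\<rho> x) (\<lambda>k y. ?L (?\<Delta> k) (\<lambda>l g2. ?L (?\<Delta> l) (\<lambda>h2 g1. ?W h1 h2 g1 g2 (mcoact M e (proj q y))))))"
  proof (rule lift_cong[where V = ?H and W = ?M], goal_cases)
    case prems: (6 h1 x)
    have "?L (?\<rho> x) (\<lambda>h2 x'. ?L (?\<rho> x') (\<lambda>g y. ?L (?\<Delta> g) (\<lambda>g1 g2. ?W h1 h2 g1 g2 (mcoact M e (proj q y)))))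
      = ?L (?\<rho> x) (\<lambda>k y. ?L (?\<Delta> k) (\<lambda>h2 g. ?L (?\<Delta> g) (\<lambda>g1 g2. ?W h1 h2 g1 g2 (mcoact M e (proj q y)))))"
      by (rule mcoact_coassoc[symmetric]) (rule A prems proj_intros | assumption)+
    also have "\<dots> = ?L (?\<rho> x) (\<lambda>k y. ?L (?\<Delta> k) (\<lambda>l g2. ?L (?\<Delta> l) (\<lambda>h2 g1. ?W h1 h2 g1 g2 (mcoact M e (proj q y)))))"
    proof (rule lift_cong[where V = ?H and W = ?M], goal_cases)
      case (6 k y)
      show ?case by (rule hcomul_coassoc[symmetric]) (rule A prems 6 proj_intros | assumption)+
    qed (rule A prems proj_intros | assumption)+
    finally show ?case .
  qed (rule A proj_intros | assumption)+
  also have "\<dots> = ?L (?\<rho> m) (\<lambda>h y. ?L (?\<Delta> h) (\<lambda>h1 k. ?L (?\<Delta> k) (\<lambda>l g2. ?L (?\<Delta> l) (\<lambda>h2 g1. ?W h1 h2 g1 g2 (mcoact M e (proj q y))))))"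
    by (rule mcoact_coassoc[symmetric]) (rule A proj_intros | assumption)+
  also have "\<dots> = ?L (?\<rho> m) (\<lambda>h y. mcoact M e (proj q (hcounit H q h \<odot>\<^bsub>?M\<^esub> y)))"
  proof (rule lift_cong[where V = ?H and W = ?M], goal_cases)
    case (6 h y)
    have "?L (?\<Delta> h) (\<lambda>h1 k. ?L (?\<Delta> k) (\<lambda>l g2. ?L (?\<Delta> l) (\<lambda>h2 g1. ?W h1 h2 g1 g2 (mcoact M e (proj q y)))))
      = hcounit H q h \<odot>\<^bsub>?Z\<^esub> mcoact M e (proj q y)"
      by (rule coaction_cancel[OF q 6(1)]) (rule A 6 proj_intros)+
    also have "\<dots> = mcoact M e (proj q (hcounit H q h \<odot>\<^bsub>?M\<^esub> y))"
      using linear_map_smult[OF linear_mcoact_comp[OF linear_proj[OF q] one_closed]] hcounit_closed[OF q] 6 by simp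
    finally show ?case .
  qed (rule A proj_intros | assumption)+
  \<comment> \<open>By linearity the remaining sum moves inside both maps, where the counit law of
    the comodule turns it into \<open>m\<close>.\<close>
  also have "\<dots> = mcoact M e (proj q (lift K ?M (?\<rho> m) (\<lambda>h y. hcounit H q h \<odot>\<^bsub>?M\<^esub> y)))"
    by (rule linear_map_of_lift[symmetric, where f = "\<lambda>x. mcoact M e (proj q x)" and V = ?H and W = ?M])
      (rule A proj_intros | assumption)+
  also have "\<dots> = mcoact M e (proj q m)" by (simp add: mcoact_counit[OF q m])
  finally show ?thesis using 1 by simp
qed

section \<open>The space of coinvariants and the behaviour of the projection on it\<close>

lemma coinvariants_iff:
  "v \<in> carrier V \<longleftrightarrow> v \<in> carrier (msp M e) \<and> mcoact M e v = pure K (hsp H e) (msp M e) (hone K H) v"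
  by (simp add: coinvariants_def)

lemma coinvariants_ops [simp]: "add V = add (msp M e)" "smult V = smult (msp M e)" "zero V = zero (msp M e)"
  by (simp_all add: coinvariants_def)

text \<open>The coinvariants are the equalizer of two linear maps, the coaction and tensoring with
  the unit, and hence a submodule of the degree-e component.\<close>

lemma module_coinvariants: "module K V"
proof -
  interpret E: module K "msp M e" by (rule module_msp) simp
  let ?\<rho> = "mcoact M e" and ?u = "pure K (hsp H e) (msp M e) (hone K H)"
  have \<rho>: "linear_map K (msp M e) (HM e) ?\<rho>" by (rule linear_mcoact) simp
  have u: "linear_map K (msp M e) (HM e) ?u" by (rule module_intros)+
  have mm: "module K (HM e)" by (rule module_intros)+
  let ?C = "{m \<in> carrier (msp M e). ?\<rho> m = ?u m}"
  have "submodule ?C K (msp M e)"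
  proof (rule E.submoduleI)
    fix a assume a: "a \<in> ?C"
    have "f (\<ominus>\<^bsub>msp M e\<^esub> a) = \<zero>\<^bsub>HM e\<^esub> \<ominus>\<^bsub>HM e\<^esub> f a" if "linear_map K (msp M e) (HM e) f" for f
      using linear_map_minus[OF E.module_axioms mm that, of "\<zero>\<^bsub>msp M e\<^esub>" a] linear_map_zero[OF E.module_axioms mm that] a
      by (simp add: E.minus_eq)
    from this[OF \<rho>] this[OF u] show "\<ominus>\<^bsub>msp M e\<^esub> a \<in> ?C" using a by simp
  qed (auto simp: linear_map_zero[OF E.module_axioms mm \<rho>] linear_map_zero[OF E.module_axioms mm u]
      linear_map_add[OF \<rho>] linear_map_add[OF u] linear_map_smult[OF \<rho>] linear_map_smult[OF u])
  then show ?thesis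
    unfolding coinvariants_def by (rule submodule.submodule_is_module[OF _ E.module_axioms])
qed

lemma linear_coinvariants_inclusion: "linear_map K V (msp M e) (\<lambda>v. v)"
  by (rule linear_mapI) (auto simp: coinvariants_iff)

text \<open>Here \<open>mcoact_proj\<close> enters. Tensors over \<open>V\<close> are cosets of
  relations built from \<open>carrier V\<close>, so they are not literally tensors over the degree-e
  component; the projection has to be linear into \<open>V\<close> itself before it can fill a
  tensor factor.\<close>

lemma linear_proj_coinvariants: "q \<in> carrier Q \<Longrightarrow> linear_map K (msp M q) V (proj q)"
  using linear_map_add[OF linear_proj, of q] linear_map_smult[OF linear_proj, of q]
  by (intro linear_mapI) (simp_all add: coinvariants_iff proj_closed mcoact_proj)

sublocale free: graded_hopf_free Q K H V
  by (intro graded_hopf_free.intro graded_hopf_free_axioms.intro graded_hopf_axioms module_coinvariants)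

lemma coinvariants_msp: "v \<in> carrier V \<Longrightarrow> v \<in> carrier (msp M e)"
  by (simp add: coinvariants_iff)

text \<open>The coaction of \<open>v\<close> is 1 \<otimes> v, so the inner sum of the compatibility
  axiom collapses and h1 1 = h1. This yields both the values of E on h \<cdot> v and the colinearity
  of the isomorphism.\<close>

lemma mcoact_act_coinvariant:
  assumes q: "q \<in> carrier Q" and h: "h \<in> carrier (hsp H q)" and v: "v \<in> carrier V"
  shows "mcoact M q (act K H M q e h v) =
    lift K (HM q) (hcomul H q h) (\<lambda>h1 h2. pure K (hsp H q) (msp M q) h1 (act K H M q e h2 v))"
proof -
  note A = q h coinvariants_msp[OF v]
  have "mcoact M q (act K H M q e h v) = lift K (HM q) (hcomul H q h) (\<lambda>h1 h2.
      lift K (HM q) (pure K (hsp H e) (msp M e) (hone K H) v) (\<lambda>m1 m0.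
        pure K (hsp H q) (msp M q) (hprod K H q e h1 m1) (act K H M q e h2 m0)))"
    using mcoact_act[OF q one_closed h coinvariants_msp[OF v]] v q by (simp add: coinvariants_iff)
  also have "\<dots> = lift K (HM q) (hcomul H q h) (\<lambda>h1 h2. pure K (hsp H q) (msp M q) h1 (act K H M q e h2 v))"
  proof (rule lift_cong[where V = "hsp H q" and W = "hsp H q"], goal_cases)
    case (6 h1 h2)
    have "lift K (HM q) (pure K (hsp H e) (msp M e) (hone K H) v) (\<lambda>m1 m0.
        pure K (hsp H q) (msp M q) (hprod K H q e h1 m1) (act K H M q e h2 m0))
      = pure K (hsp H q) (msp M q) (hprod K H q e h1 (hone K H)) (act K H M q e h2 v)"
      by (rule lift_pure) (rule A 6 proj_intros | assumption)+
    then show ?case using 6 q by (simp add: hprod_hone)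
  qed (rule A proj_intros | assumption)+
  finally show ?thesis .
qed

text \<open>With the coaction of h \<cdot> v known, E becomes the sum of S(h1) \<cdot> (h2 \<cdot>
  v), which is the left quasimodule axiom in degree e.\<close>

lemma proj_act_coinvariant:
  assumes q: "q \<in> carrier Q" and h: "h \<in> carrier (hsp H q)" and v: "v \<in> carrier V"
  shows "proj q (act K H M q e h v) = hcounit H q h \<odot>\<^bsub>V\<^esub> v"
proof -
  note A = q h coinvariants_msp[OF v]
  let ?H = "hsp H q" and ?M = "msp M q"
  have "proj q (act K H M q e h v) = lift K (msp M e) (hcomul H q h) (\<lambda>h1 h2.
      lift K (msp M e) (pure K ?H ?M h1 (act K H M q e h2 v)) (\<lambda>h x. act K H M (qinv Q q) q (hanti H q h) x))"
    unfolding proj_def mcoact_act_coinvariant[OF assms]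
    by (rule lift_of_lift) (rule A proj_intros | assumption)+
  also have "\<dots> = lift K (msp M e) (hcomul H q h) (\<lambda>h1 h2. act K H M (qinv Q q) q (hanti H q h1) (act K H M q e h2 v))"
  proof (rule lift_cong[where V = ?H and W = ?H], goal_cases)
    case (6 h1 h2)
    show ?case by (rule lift_pure) (rule A 6 proj_intros | assumption)+
  qed (rule A proj_intros | assumption)+
  also have "\<dots> = hcounit H q h \<odot>\<^bsub>msp M e\<^esub> v"
    using act_anti_left_eq[OF q one_closed h coinvariants_msp[OF v]] q by (simp add: act_anti_left_def)
  finally show ?thesis by simp
qed

section \<open>The two mutually inverse linear maps\<close>

definition from_free :: "'q \<Rightarrow> ('k, 'h, 'm) tens \<Rightarrow> 'm" where
  "from_free q t = lift K (msp M q) t (\<lambda>h v. act K H M q e h v)"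

definition to_free :: "'q \<Rightarrow> 'm \<Rightarrow> ('k, 'h, 'm) tens" where
  "to_free q m = lift K (free.T q) (mcoact M q m) (\<lambda>h x. pure K (hsp H q) V h (proj q x))"

lemma linear_act_coinvariant:
  "q \<in> carrier Q \<Longrightarrow> h \<in> carrier (hsp H q) \<Longrightarrow> linear_map K V (msp M q) (\<lambda>v. act K H M q e h v)"
  by (rule linear_act_right[OF linear_coinvariants_inclusion]) auto

lemma linear_proj_coinvariants_comp: "linear_map K U (msp M q) f \<Longrightarrow> q \<in> carrier Q \<Longrightarrow>
    linear_map K U V (\<lambda>u. proj q (f u))"
  by (rule linear_map_comp[OF linear_proj_coinvariants])

lemma proj_coinvariants: "q \<in> carrier Q \<Longrightarrow> m \<in> carrier (msp M q) \<Longrightarrow> proj q m \<in> carrier V"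
  by (rule linear_map_closed[OF linear_proj_coinvariants])

lemma bilinear_act_coinvariant:
  assumes "q \<in> carrier Q" shows "bilinear_map K (hsp H q) V (msp M q) (\<lambda>h v. act K H M q e h v)"
  by (rule assms linear_act_coinvariant coinvariants_msp proj_intros | assumption)+

lemma linear_from_free: "q \<in> carrier Q \<Longrightarrow> linear_map K (free.T q) (msp M q) (from_free q)"
  unfolding from_free_def
  by (rule linear_lift) (rule module_hsp module_msp module_coinvariants bilinear_act_coinvariant | assumption)+

lemma from_free_pure: "q \<in> carrier Q \<Longrightarrow> h \<in> carrier (hsp H q) \<Longrightarrow> v \<in> carrier V \<Longrightarrow>
    from_free q (pure K (hsp H q) V h v) = act K H M q e h v"
  unfolding from_free_def
  by (rule lift_pure) (rule module_hsp module_msp module_coinvariants bilinear_act_coinvariant | assumption)+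

lemma linear_from_free_comp: "linear_map K U (free.T q) f \<Longrightarrow> q \<in> carrier Q \<Longrightarrow>
    linear_map K U (msp M q) (\<lambda>u. from_free q (f u))"
  by (rule linear_map_comp[OF linear_from_free])

lemmas iso_intros = linear_proj_coinvariants_comp proj_coinvariants module_coinvariants linear_act_coinvariant
  linear_from_free_comp linear_map_closed[OF linear_from_free] coinvariants_msp free.free_intros proj_intros

lemma linear_to_free: "q \<in> carrier Q \<Longrightarrow> linear_map K (msp M q) (free.T q) (to_free q)"
  unfolding to_free_def by (rule iso_intros | assumption)+

lemma from_free_to_free:
  assumes q: "q \<in> carrier Q" and m: "m \<in> carrier (msp M q)"
  shows "from_free q (to_free q m) = m"
proof -
  let ?H = "hsp H q" and ?M = "msp M q"
  have "from_free q (to_free q m) = lift K ?M (mcoact M q m) (\<lambda>h x. from_free q (pure K ?H V h (proj q x)))"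
    unfolding to_free_def
    by (rule linear_map_of_lift[where f = "from_free q" and V = ?H and W = ?M and Z = "free.T q"])
      (rule q m iso_intros linear_from_free | assumption)+
  also have "\<dots> = lift K ?M (mcoact M q m) (\<lambda>h x. act K H M q e h (proj q x))"
    by (rule lift_cong[where V = ?H and W = ?M]) (rule q m from_free_pure iso_intros | assumption)+
  finally show ?thesis using act_proj[OF q m] by simp
qed

text \<open>A pure tensor h \<otimes> v goes to the sum of h1 \<otimes> E(h2 \<cdot> v) = h1
  \<otimes> \<epsilon>(h2) v. The scalar crosses the tensor sign and the right counit law restores
  h.\<close>

lemma to_free_from_free:
  assumes q: "q \<in> carrier Q" and t: "t \<in> carrier (free.T q)"
  shows "to_free q (from_free q t) = t"
proof (rule tensor_ext[OF module_hsp[OF q] module_coinvariants free.module_T[OF q] _ linear_map_id _ t], goal_cases)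
  case 1
  show ?case by (rule linear_map_comp[OF linear_to_free linear_from_free]) (rule q)+
next
  case (2 h v)
  note A = q 2
  let ?H = "hsp H q" and ?M = "msp M q"
  have "to_free q (from_free q (pure K ?H V h v)) = lift K (free.T q) (hcomul H q h) (\<lambda>h1 h2.
      lift K (free.T q) (pure K ?H ?M h1 (act K H M q e h2 v)) (\<lambda>h x. pure K ?H V h (proj q x)))"
    unfolding from_free_pure[OF A] to_free_def mcoact_act_coinvariant[OF A]
    by (rule lift_of_lift) (rule A iso_intros | assumption)+
  also have "\<dots> = lift K (free.T q) (hcomul H q h) (\<lambda>h1 h2. pure K ?H V (hcounit H q h2 \<odot>\<^bsub>?H\<^esub> h1) v)"
  proof (rule lift_cong[where V = ?H and W = ?H], goal_cases)
    case (6 h1 h2)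
    have "lift K (free.T q) (pure K ?H ?M h1 (act K H M q e h2 v)) (\<lambda>h x. pure K ?H V h (proj q x))
      = pure K ?H V h1 (proj q (act K H M q e h2 v))"
      by (rule lift_pure) (rule A 6 iso_intros | assumption)+
    also have "\<dots> = pure K ?H V h1 (hcounit H q h2 \<odot>\<^bsub>V\<^esub> v)"
      by (simp only: proj_act_coinvariant[OF q 6(2) 2(2)])
    also have "\<dots> = hcounit H q h2 \<odot>\<^bsub>free.T q\<^esub> pure K ?H V h1 v"
      by (rule smult_pure_right) (rule A 6 iso_intros | assumption)+
    also have "\<dots> = pure K ?H V (hcounit H q h2 \<odot>\<^bsub>?H\<^esub> h1) v"
      by (rule smult_pure_left[symmetric]) (rule A 6 iso_intros | assumption)+
    finally show ?case .
  qed (rule A iso_intros | assumption)+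
  also have "\<dots> = pure K ?H V (lift K ?H (hcomul H q h) (\<lambda>h1 h2. hcounit H q h2 \<odot>\<^bsub>?H\<^esub> h1)) v"
    by (rule free.lift_pure_left) (rule A iso_intros | assumption)+
  finally show ?case by (simp only: hcounit_right[OF q 2(1)])
qed

section \<open>Compatibility with action and coaction\<close>

lemma from_free_quasimodule_map: "graded_quasimodule_map K Q H free.F M from_free"
  unfolding graded_quasimodule_map_def free.msp_free
proof (intro conjI ballI)
  fix p q h s assume A: "p \<in> carrier Q" "q \<in> carrier Q" "h \<in> carrier (hsp H p)" "s \<in> carrier (free.T q)"
  show "from_free q (act_anti_right K Q H free.F p q h s) = act_anti_right K Q H M p q h (from_free q s)"
    unfolding free.act_anti_right_free[OF A]
      act_anti_right_eq[OF A(1-3) linear_map_closed[OF linear_from_free[OF A(2)] A(4)]]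
    by (rule linear_map_smult[OF linear_from_free[OF A(2)] hcounit_closed[OF A(1,3)] A(4)])
qed (rule linear_from_free)

text \<open>On h \<otimes> v both sides are the sum of h1 \<otimes> (h2 \<cdot> v); for the
  right-hand side this is where coinvariance of \<open>v\<close> enters.\<close>

lemma from_free_coaction:
  assumes q: "q \<in> carrier Q" and t: "t \<in> carrier (free.T q)"
  shows "tensor_map K (hsp H q) (msp M q) (\<lambda>x. x) (from_free q) (mcoact free.F q t) = mcoact M q (from_free q t)"
  unfolding tensor_map_def
proof (rule tensor_ext[OF module_hsp[OF q] module_coinvariants _ _ _ _ t, where Z = "HM q"], goal_cases)
  case (4 h v)
  note A = q 4
  let ?H = "hsp H q" and ?M = "msp M q"
  have "lift K (HM q) (mcoact free.F q (pure K ?H V h v)) (\<lambda>h s. pure K ?H ?M h (from_free q s)) =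
    lift K (HM q) (hcomul H q h) (\<lambda>h1 h2. pure K ?H ?M h1 (from_free q (pure K ?H V h2 v)))"
    by (rule free.lift_mcoact_free_pure) (rule A iso_intros | assumption)+
  also have "\<dots> = lift K (HM q) (hcomul H q h) (\<lambda>h1 h2. pure K ?H ?M h1 (act K H M q e h2 v))"
  proof (rule lift_cong[where V = ?H and W = ?H], goal_cases)
    case (6 h1 h2)
    show ?case by (simp only: from_free_pure[OF q 6(2) 4(2)])
  qed (rule A iso_intros | assumption)+
  also have "\<dots> = mcoact M q (from_free q (pure K ?H V h v))"
    unfolding from_free_pure[OF A] by (rule mcoact_act_coinvariant[OF A, symmetric])
  finally show ?case .
qed (rule q iso_intros linear_from_free | assumption)+

lemma from_free_iso: "graded_hopf_quasimodule_iso K Q H free.F M from_free"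
  unfolding graded_hopf_quasimodule_iso_def graded_hopf_quasimodule_map_def free.msp_free
proof (intro conjI ballI)
  fix q assume q: "q \<in> carrier Q"
  show "bij_betw (from_free q) (carrier (free.T q)) (carrier (msp M q))"
    by (rule bij_betw_byWitness[where f' = "to_free q"])
      (use to_free_from_free[OF q] from_free_to_free[OF q] linear_map_closed[OF linear_from_free[OF q]]
        linear_map_closed[OF linear_to_free[OF q]] in auto)
qed (rule from_free_quasimodule_map from_free_coaction | assumption)+

end

theorem theorem4p11:
  fixes K :: "'k ring" and Q :: "'q monoid"
    and H :: "('q, 'k, 'h) hopf_data" and M :: "('q, 'k, 'h, 'm) hopf_quasimod_data"
  assumes "field K"
    and "quasigroup Q"
    and "graded_hopf_quasigroup K Q H"
    and "graded_hopf_quasimodule K Q H M"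
  shows "graded_hopf_quasimodule K Q H (free_hopf_quasimodule K Q H (coinvariants K Q H M)) \<and>
    (\<exists>f. graded_hopf_quasimodule_iso K Q H
           (free_hopf_quasimodule K Q H (coinvariants K Q H M)) M f)"
proof -
  interpret field K by fact
  interpret graded_hopf_module Q K H M
    by (intro graded_hopf_module.intro graded_hopf.intro quasigroup_inverses.intro graded_hopf_axioms.intro
        graded_hopf_module_axioms.intro assms is_cring)
  show ?thesis
    using free.graded_hopf_quasimodule_free from_free_iso by blast
qed

end
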